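(* Let $\alpha$ be a set with involution $\tau$. A multiplicity-one-free word of length 5 in the alphabet $\alpha$ has one of the forms (I) $aaabb, aabba, abbaa, bbaaa$ or (II) $a^5=aaaaa, abaab, baaba, aabab, babaa, baaab, ababa$, with distinct $a,b\in\alpha$. The words of type (I) are homotopic to $aaa$; they are contractible if and only if $\tau(a)=a$. The words $a^5$ and $baaab$ are contractible if and only if $\tau(a)=a$. The word $ababa$ is contractible if and only if $\tau(a)=b$. The words $abaab, baaba, aabab, babaa$ are not contractible. Two non-contractible words of type (II) are homotopic if and only if they coincide letterwise, with the following exception: $aabab\simeq babaa\simeq baaab$ for $a=\tau(b)\neq b$. Non-contractible words of type (II) are not homotopic to words in the alphabet $\alpha$ of length $\le 4$.
   Context: Fix a set $\alpha$ with an involution $\tau:\alpha\to\alpha$. An $\alpha$-alphabet is a set $\mathcal A$ with a map $\mathcal A\to\alpha$, $A\mapsto|A|$. An étale word over $\alpha$ is a pair $(\mathcal A,w)$ with $\mathcal A$ an $\alpha$-alphabet and $w$ a finite word in letters of $\mathcal A$; two étale words $(\mathcal A_1,w_1),(\mathcal A_2,w_2)$ are isomorphic if there is a bijection $f:\mathcal A_1\to\mathcal A_2$ with $|f(A)|=|A|$ and $w_2$ is $w_1$ with $f$ applied letterwise. A nanoword is an étale word with $\mathcal A$ finite and every letter of $\mathcal A$ occurring exactly twice in $w$. Homotopy moves on nanowords ($x,y,z,t$ words in the remaining letters; smaller alphabets carry the restricted projection): (1) $(\mathcal A,xAAy)\mapsto(\mathcal A\setminus\{A\},xy)$; (2) $(\mathcal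 A,xAByBAz)\mapsto(\mathcal A\setminus\{A,B\},xyz)$ if $|B|=\tau(|A|)$; (3) $(\mathcal A,xAByACzBCt)\mapsto(\mathcal A,xBAyCAzCBt)$ if $A,B,C$ are distinct and $|A|=|B|=|C|$. Homotopy of nanowords is the equivalence relation generated by isomorphisms, these moves and their inverses. Desingularization: for an étale word $(\mathcal A,w)$ with $m_w(A)$ the number of occurrences of $A$, let $\mathcal A^d=\{A_{i,j}: A\in\mathcal A, 1\le i<j\le m_w(A)\}$ with $|A_{i,j}|=|A|$, and let $w^d$ be obtained from $w$ by deleting letters of multiplicity 1 and replacing the $i$-th occurrence of each $A$ with $m=m_w(A)\ge2$ by $A_{1,i}A_{2,i}\cdots A_{i-1,i}A_{i,i+1}\cdots A_{i,m}$; then $(\mathcal A^d,w^d)$ is a nanoword. Two étale words are homotopic ($\simeq$) if their desingularizations are homotopic nanowords; an étale word is contractible if its desingularization is homotopic to the empty nanoword. A word $w$ in the alphabet $\alpha$ is regarded as the étale word $(\alpha,w)$ with identity projection. A word is multiplicity-one-free if every letter occurring in it occurs at least twice. *)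

theory Defs
  imports Main
begin

text \<open>Nanowords over the alphabet-type 'a (carrying the involution), with letters of type 'l.
  A nanoword is a triple (A, p, w): a finite alphabet A, a projection p (only its values on A
  matter) and a word w in which every letter of A occurs exactly twice.\<close>

type_synonym ('l, 'a) nw = "'l set \<times> ('l \<Rightarrow> 'a) \<times> 'l list"

definition is_nanoword :: "('l, 'a) nw \<Rightarrow> bool" where
  "is_nanoword X = (case X of (A, p, w) \<Rightarrow>
      finite A \<and> set w \<subseteq> A \<and> (\<forall>x\<in>A. count_list w x = 2))"

inductive nw_move :: "('a \<Rightarrow> 'a) \<Rightarrow> ('l, 'a) nw \<Rightarrow> ('l, 'a) nw \<Rightarrow> bool"
  for \<tau> :: "'a \<Rightarrow> 'a" where
  iso: "\<lbrakk> is_nanoword (A, p, w); bij_betw f A B; \<forall>x\<in>A. q (f x) = p x \<rbrakk>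
        \<Longrightarrow> nw_move \<tau> (A, p, w) (B, q, map f w)"
| move1: "\<lbrakk> is_nanoword (A, p, x @ [a, a] @ y) \<rbrakk>
        \<Longrightarrow> nw_move \<tau> (A, p, x @ [a, a] @ y) (A - {a}, p, x @ y)"
| move2: "\<lbrakk> is_nanoword (A, p, x @ [a, b] @ y @ [b, a] @ z); a \<noteq> b; p b = \<tau> (p a) \<rbrakk>
        \<Longrightarrow> nw_move \<tau> (A, p, x @ [a, b] @ y @ [b, a] @ z) (A - {a, b}, p, x @ y @ z)"
| move3: "\<lbrakk> is_nanoword (A, p, x @ [a, b] @ y @ [a, c] @ z @ [b, c] @ t);
            a \<noteq> b; a \<noteq> c; b \<noteq> c; p a = p b; p b = p c \<rbrakk>
        \<Longrightarrow> nw_move \<tau> (A, p, x @ [a, b] @ y @ [a, c] @ z @ [b, c] @ t)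
                        (A, p, x @ [b, a] @ y @ [c, a] @ z @ [c, b] @ t)"

definition nw_homotopic :: "('a \<Rightarrow> 'a) \<Rightarrow> ('l, 'a) nw \<Rightarrow> ('l, 'a) nw \<Rightarrow> bool" where
  "nw_homotopic \<tau> = (\<lambda>X Y. nw_move \<tau> X Y \<or> nw_move \<tau> Y X)\<^sup>*\<^sup>*"

text \<open>Desingularization of an etale word (A, p, w): the letter A_{i,j} is (A, i, j).
  The k-th position of w, carrying letter a as its i-th occurrence (m = multiplicity of a),
  is replaced by A_{1,i} ... A_{i-1,i} A_{i,i+1} ... A_{i,m}  (empty if m = 1).\<close>

definition desing_word :: "'l list \<Rightarrow> ('l \<times> nat \<times> nat) list" where
  "desing_word w = concat (map (\<lambda>k.
      let a = w ! k; i = count_list (take (Suc k) w) a; m = count_list w a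
      in map (\<lambda>l. (a, l, i)) [1..<i] @ map (\<lambda>l. (a, i, l)) [Suc i..<Suc m])
    [0..<length w])"

definition desing :: "('l, 'a) nw \<Rightarrow> ('l \<times> nat \<times> nat, 'a) nw" where
  "desing X = (case X of (A, p, w) \<Rightarrow>
      ({(a, i, j). a \<in> A \<and> 1 \<le> i \<and> i < j \<and> j \<le> count_list w a}, p \<circ> fst, desing_word w))"

definition word_homotopic :: "('a \<Rightarrow> 'a) \<Rightarrow> 'a list \<Rightarrow> 'a list \<Rightarrow> bool" where
  "word_homotopic \<tau> u v = nw_homotopic \<tau> (desing (UNIV, id, u)) (desing (UNIV, id, v))"

definition contractible :: "('a \<Rightarrow> 'a) \<Rightarrow> 'a list \<Rightarrow> bool" where
  "contractible \<tau> w = nw_homotopic \<tau> (desing (UNIV, id, w))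
                        ({} :: ('a \<times> nat \<times> nat) set, fst, [])"

definition mult_one_free :: "'a list \<Rightarrow> bool" where
  "mult_one_free w = (\<forall>x\<in>set w. count_list w x \<ge> 2)"

definition typeI_words :: "'a \<Rightarrow> 'a \<Rightarrow> 'a list set" where
  "typeI_words a b = {[a,a,a,b,b], [a,a,b,b,a], [a,b,b,a,a], [b,b,a,a,a]}"

definition typeII_words :: "'a \<Rightarrow> 'a \<Rightarrow> 'a list set" where
  "typeII_words a b = {[a,a,a,a,a], [a,b,a,a,b], [b,a,a,b,a], [a,a,b,a,b], [b,a,b,a,a],
                       [b,a,a,a,b], [a,b,a,b,a]}"

definition is_typeI :: "'a list \<Rightarrow> bool" where
  "is_typeI w = (\<exists>a b. a \<noteq> b \<and> w \<in> typeI_words a b)"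

text \<open>The word a^5 involves only one letter, so no distinct b is required for it.\<close>
definition is_typeII :: "'a list \<Rightarrow> bool" where
  "is_typeII w = ((\<exists>a. w = replicate 5 a) \<or> (\<exists>a b. a \<noteq> b \<and> w \<in> typeII_words a b))"

end

theory Submission
  imports Defs Complex_Main "HOL-Library.Product_Plus"
begin

text \<open>Walk along a nanoword carrying a color \<open>q\<close> from a module. At the first occurrence of a letter \<open>A\<close>
  with \<open>|A| = a\<close>, remember \<open>q\<close> as \<open>d\<close> and replace \<open>q\<close> by \<open>f\<^sub>a q\<close>; at the second occurrence replace \<open>q\<close> by
  \<open>s\<^sub>a q + (1 - s\<^sub>a f\<^sub>a) d\<close>. If \<open>s\<^sub>a\<close> and \<open>f\<^sub>a\<close> are commuting automorphisms with \<open>s\<^sub>\<tau>\<^sub>a = s\<^sub>a\<^sup>-\<^sup>1\<close> and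
  \<open>f\<^sub>\<tau>\<^sub>a = f\<^sub>a\<^sup>-\<^sup>1\<close>, then the final color is a homotopy invariant, an Alexander-type invariant of long flat
  virtual knots. Specializing the automorphisms to rational scalars supported on one or two orbits of
  \<open>\<tau>\<close>, and to 2 by 2 integer matrices when the letters are fixed by \<open>\<tau>\<close>, separates all words that are not homotopic.
  The homotopies are explicit sequences of moves; besides the defining moves they use the removal
  of a pair \<open>AB...AB\<close> with \<open>|B| = \<tau>(|A|)\<close>, which is derived by inserting two auxiliary pairs of letters.\<close>

section \<open>Colorings of nanowords\<close>

text \<open>The state of a run is a pair (\<open>st\<close>, \<open>q\<close>): the current color \<open>q\<close>, and for every letter that has
  been met exactly once the color \<open>st l = Some d\<close> that arrived at its first occurrence.\<close>

definition nw_step :: "('a \<Rightarrow> 'q \<Rightarrow> 'q) \<Rightarrow> ('a \<Rightarrow> 'q \<Rightarrow> 'q \<Rightarrow> 'q) \<Rightarrow> ('l \<Rightarrow> 'a) \<Rightarrow>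
    'l \<Rightarrow> ('l \<Rightarrow> 'q option) \<times> 'q \<Rightarrow> ('l \<Rightarrow> 'q option) \<times> 'q" where
  "nw_step F G p l S = (case fst S l of
       None \<Rightarrow> ((fst S)(l := Some (snd S)), F (p l) (snd S))
     | Some d \<Rightarrow> ((fst S)(l := None), G (p l) (snd S) d))"

fun nw_run :: "('a \<Rightarrow> 'q \<Rightarrow> 'q) \<Rightarrow> ('a \<Rightarrow> 'q \<Rightarrow> 'q \<Rightarrow> 'q) \<Rightarrow> ('l \<Rightarrow> 'a) \<Rightarrow>
    'l list \<Rightarrow> ('l \<Rightarrow> 'q option) \<times> 'q \<Rightarrow> ('l \<Rightarrow> 'q option) \<times> 'q" where
  "nw_run F G p [] S = S"
| "nw_run F G p (l # w) S = nw_run F G p w (nw_step F G p l S)"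

lemma nw_run_append [simp]: "nw_run F G p (v @ w) S = nw_run F G p w (nw_run F G p v S)"
  by (induction v arbitrary: S) simp_all

definition nw_color :: "('a \<Rightarrow> 'q \<Rightarrow> 'q) \<Rightarrow> ('a \<Rightarrow> 'q \<Rightarrow> 'q \<Rightarrow> 'q) \<Rightarrow> 'q \<Rightarrow> ('l, 'a) nw \<Rightarrow> 'q" where
  "nw_color F G q X = (case X of (A, p, w) \<Rightarrow> snd (nw_run F G p w (\<lambda>_. None, q)))"

lemma nw_run_unused:
  "l \<notin> set w \<Longrightarrow> fst (nw_run F G p w S) l = fst S l"
  by (induction w arbitrary: S) (auto simp: nw_step_def split: option.splits)

text \<open>A color stored for a letter that the word does not contain stays inert during the run.
  Stored colors can thus be pulled out of the subwords lying between the letters of a move.\<close>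

lemma nw_run_upd:
  "l \<notin> set w \<Longrightarrow> nw_run F G p w (st(l := v), q) =
     ((fst (nw_run F G p w (st, q)))(l := v), snd (nw_run F G p w (st, q)))"
proof (induction w arbitrary: st q)
  case (Cons k w)
  then have "k \<noteq> l" by auto
  have IH: "nw_run F G p w (st(l := v), q) =
     ((fst (nw_run F G p w (st, q)))(l := v), snd (nw_run F G p w (st, q)))" for st q
    by (rule Cons.IH) (use Cons.prems in auto)
  from \<open>k \<noteq> l\<close> have "st(l := v, k := u) = st(k := u, l := v)" for u by (simp add: fun_upd_twist)
  with \<open>k \<noteq> l\<close> show ?case
    by (cases "st k") (simp_all add: nw_step_def IH fun_upd_other del: fun_upd_apply)
qed simp

lemma nw_run_map:
  assumes "inj_on f A" "set w \<subseteq> A" "\<forall>x\<in>A. r (f x) = p x" "\<forall>x\<in>A. st' (f x) = st x"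
  shows "snd (nw_run F G r (map f w) (st', q)) = snd (nw_run F G p w (st, q))"
  using assms(2,4)
proof (induction w arbitrary: st st' q)
  case (Cons k w)
  have "\<forall>x\<in>A. (st'(f k := v)) (f x) = (st(k := v)) x" for v
    using Cons.prems assms(1) by (auto simp: inj_on_def)
  then show ?case
    using Cons.prems Cons.IH assms(3) by (auto simp: nw_step_def split: option.splits)
qed simp

text \<open>The axiom \<open>G_F\<close> gives invariance under move (1), \<open>F_F\<close> and \<open>G_G\<close> under move (2), and
  \<open>F_G\<close> and \<open>G_dist\<close> under move (3).\<close>

locale nw_coloring =
  fixes \<tau> :: "'a \<Rightarrow> 'a" and F :: "'a \<Rightarrow> 'q \<Rightarrow> 'q" and G :: "'a \<Rightarrow> 'q \<Rightarrow> 'q \<Rightarrow> 'q"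
  assumes G_F: "G a (F a q) q = q"
    and F_F: "F (\<tau> a) (F a q) = q"
    and G_G: "G a (G (\<tau> a) v (F a q)) q = v"
    and F_G: "F a (G a v q) = G a (F a v) (F a q)"
    and G_dist: "G a (G a v (F a q)) (G a u q) = G a (G a v u) q"
begin

text \<open>Since every letter occurs exactly twice, the letters displayed in a move are absent from
  the surrounding subwords. The effect of a move is confined to the current color and the entries of
  these letters, where the axioms apply.\<close>

lemma nw_color_move:
  assumes "nw_move \<tau> X Y"
  shows "nw_color F G q0 X = nw_color F G q0 Y"
  using assms
proof cases
  case (iso A p w f B r)
  then have "snd (nw_run F G r (map f w) (\<lambda>_. None, q0)) = snd (nw_run F G p w (\<lambda>_. None, q0))"
    by (intro nw_run_map[of f A]) (auto simp: is_nanoword_def bij_betw_def)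
  with iso show ?thesis by (simp add: nw_color_def)
next
  case (move1 A p x a y)
  obtain st q where S: "nw_run F G p x (\<lambda>_. None, q0) = (st, q)" by fastforce
  \<comment> \<open>Both occurrences of \<open>a\<close> are displayed, so the first one shown is
    the one that stores a color.\<close>
  from move1 have "count_list (x @ [a, a] @ y) a = 2" by (auto simp: is_nanoword_def)
  then have "a \<notin> set x" by (auto simp: count_list_0_iff)
  with S have "st a = None" using nw_run_unused[of a x F G p "(\<lambda>_. None, q0)"] by simp
  then have "nw_step F G p a (nw_step F G p a (st, q)) = (st, q)"
    by (simp add: nw_step_def G_F fun_upd_idem)
  with move1 S show ?thesis by (simp add: nw_color_def)
next
  case (move2 A p x a b y z)
  obtain st q where S: "nw_run F G p x (\<lambda>_. None, q0) = (st, q)" by fastforce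
  obtain st' q' where S': "nw_run F G p y (st, q) = (st', q')" by fastforce
  from move2 have "count_list (x @ [a, b] @ y @ [b, a] @ z) a = 2"
    "count_list (x @ [a, b] @ y @ [b, a] @ z) b = 2" by (auto simp: is_nanoword_def)
  with move2 have ns: "a \<notin> set x" "b \<notin> set x" "a \<notin> set y" "b \<notin> set y" by (auto simp: count_list_0_iff)
  with S have N: "st a = None" "st b = None"
    using nw_run_unused[of a x F G p "(\<lambda>_. None, q0)"] nw_run_unused[of b x F G p "(\<lambda>_. None, q0)"]
    by simp_all
  with S' ns have N': "st' a = None" "st' b = None"
    using nw_run_unused[of a y F G p "(st, q)"] nw_run_unused[of b y F G p "(st, q)"] by simp_all
  have "nw_run F G p ([a, b] @ y @ [b, a]) (st, q) = (st', q')"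
    using move2(4,5) N N' ns S'
    by (simp add: nw_step_def F_F G_G nw_run_upd fun_upd_idem fun_upd_twist)
  with move2 S S' show ?thesis by (simp add: nw_color_def)
next
  case (move3 A p x a b y c z t)
  let ?w = "x @ [a, b] @ y @ [a, c] @ z @ [b, c] @ t"
  obtain st q where S: "nw_run F G p x (\<lambda>_. None, q0) = (st, q)" by fastforce
  \<comment> \<open>\<open>u\<close> and \<open>v\<close> are the colors leaving \<open>y\<close>
    and \<open>z\<close>. \<open>F_G\<close> makes the color entering \<open>z\<close> agree on both
    sides of the move, and \<open>G_dist\<close> the color entering \<open>t\<close>.\<close>
  let ?e = "p b"
  obtain st1 u where S1: "nw_run F G p y (st, F ?e (F ?e q)) = (st1, u)" by fastforce
  obtain st2 v where S2: "nw_run F G p z (st1, F ?e (G ?e u q)) = (st2, v)" by fastforce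
  from move3 have "count_list ?w a = 2" "count_list ?w b = 2" "count_list ?w c = 2"
    by (auto simp: is_nanoword_def)
  with move3 have ns: "a \<notin> set x" "b \<notin> set x" "c \<notin> set x" "a \<notin> set y" "b \<notin> set y" "c \<notin> set y"
    "a \<notin> set z" "b \<notin> set z" "c \<notin> set z" by (auto simp: count_list_0_iff)
  with S have N: "st a = None" "st b = None" "st c = None"
    using nw_run_unused[of a x F G p "(\<lambda>_. None, q0)"] nw_run_unused[of b x F G p "(\<lambda>_. None, q0)"]
      nw_run_unused[of c x F G p "(\<lambda>_. None, q0)"]
    by simp_all
  with S1 ns have N1: "st1 a = None" "st1 b = None" "st1 c = None"
    using nw_run_unused[of a y F G p "(st, F ?e (F ?e q))"] nw_run_unused[of b y F G p "(st, F ?e (F ?e q))"]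
      nw_run_unused[of c y F G p "(st, F ?e (F ?e q))"] by simp_all
  have "nw_run F G p ([a, b] @ y @ [a, c] @ z @ [b, c]) (st, q) =
        nw_run F G p ([b, a] @ y @ [c, a] @ z @ [c, b]) (st, q)"
    using move3(4-6) move3(7,8)[symmetric] N N1 ns S1 S2
    by (simp add: nw_step_def nw_run_upd fun_upd_idem fun_upd_twist F_G[symmetric] G_dist)
  then have "nw_run F G p t (nw_run F G p ([a, b] @ y @ [a, c] @ z @ [b, c]) (st, q)) =
        nw_run F G p t (nw_run F G p ([b, a] @ y @ [c, a] @ z @ [c, b]) (st, q))" by simp
  with move3(1,2) S show ?thesis by (simp add: nw_color_def)
qed

lemma nw_color_homotopic:
  assumes "nw_homotopic \<tau> X Y"
  shows "nw_color F G q X = nw_color F G q Y"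
  using assms unfolding nw_homotopic_def
  by (induction rule: rtranclp_induct) (auto dest: nw_color_move[of _ _ q])

end

definition word_color :: "('a \<Rightarrow> 'q \<Rightarrow> 'q) \<Rightarrow> ('a \<Rightarrow> 'q \<Rightarrow> 'q \<Rightarrow> 'q) \<Rightarrow> 'q \<Rightarrow> 'a list \<Rightarrow> 'q" where
  "word_color F G q w = snd (nw_run F G fst (desing_word w) (\<lambda>_. None, q))"

lemma (in nw_coloring) word_color_homotopic:
  "word_homotopic \<tau> u v \<Longrightarrow> word_color F G q u = word_color F G q v"
  using nw_color_homotopic[of "desing (UNIV, id, u)" "desing (UNIV, id, v)" q]
  by (simp add: word_homotopic_def word_color_def nw_color_def desing_def)

text \<open>For linear colorings all axioms reduce to the conditions that \<open>s a\<close> and \<open>f a\<close> commute and that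
  \<open>s (\<tau> a)\<close> and \<open>f (\<tau> a)\<close> are their inverses; maps of different letters need not commute.\<close>

definition lin_color where
  "lin_color s f = word_color f (\<lambda>a v d. s a v + (d - s a (f a d)))"

lemma lin_color_homotopic:
  fixes s f :: "'a \<Rightarrow> 'q::ab_group_add \<Rightarrow> 'q"
  assumes "\<And>a x y. s a (x - y) = s a x - s a y" "\<And>a x y. f a (x - y) = f a x - f a y"
    and "\<And>a x. s a (s (\<tau> a) x) = x" "\<And>a x. f (\<tau> a) (f a x) = x"
    and "\<And>a x. f a (s a x) = s a (f a x)"
    and "word_homotopic \<tau> u v"
  shows "lin_color s f q u = lin_color s f q v"
proof -
  have s0: "s a 0 = 0" for a using assms(1)[of a 0 0] by simp
  have f0: "f a 0 = 0" for a using assms(2)[of a 0 0] by simp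
  have sp: "s a (x + y) = s a x + s a y" for a x y
    using assms(1)[of a x "- y"] assms(1)[of a 0 y] s0 by simp
  have fp: "f a (x + y) = f a x + f a y" for a x y
    using assms(2)[of a x "- y"] assms(2)[of a 0 y] f0 by simp
  interpret nw_coloring \<tau> f "\<lambda>a v d. s a v + (d - s a (f a d))"
    by unfold_locales (simp_all add: assms(1-5) sp fp algebra_simps)
  show ?thesis unfolding lin_color_def using word_color_homotopic[OF assms(6)] .
qed

section \<open>Homotopy of Gauss words\<close>

definition gauss :: "'l list \<Rightarrow> bool" where
  "gauss w = (\<forall>l\<in>set w. count_list w l = 2)"

text \<open>Letters carry their projection as first component and the alphabet consists of the
  occurring letters, so a nanoword of this kind is just a word and moves become rewriting of
  words.\<close>

definition word_nw :: "('a \<times> 'i) list \<Rightarrow> ('a \<times> 'i, 'a) nw" where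
  "word_nw w = (set w, fst, w)"

text \<open>The Gauss condition is part of the relation so that it passes along chains of
  moves.\<close>

definition heq :: "('a \<Rightarrow> 'a) \<Rightarrow> ('a \<times> 'i) list \<Rightarrow> ('a \<times> 'i) list \<Rightarrow> bool" where
  "heq \<tau> v w = (gauss v \<and> gauss w \<and> nw_homotopic \<tau> (word_nw v) (word_nw w))"

lemma gauss_iff: "gauss w = (\<forall>l. count_list w l \<in> {0, 2})"
  unfolding gauss_def using count_list_0_iff by fastforce

lemma gauss_cong: "gauss v \<Longrightarrow> (\<And>l. count_list v l = count_list w l) \<Longrightarrow> gauss w"
  by (simp add: gauss_iff)

lemma gauss_Cons_Cons: "gauss (a # a # w) \<longleftrightarrow> a \<notin> set w \<and> gauss w"
proof -
  have "gauss (a # a # w) \<longleftrightarrow> count_list w a = 0 \<and> (\<forall>l. l \<noteq> a \<longrightarrow> count_list w l \<in> {0, 2})"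
    unfolding gauss_iff by (auto split: if_splits)
  then show ?thesis unfolding gauss_iff by (metis count_list_0_iff insertI1)
qed

lemma gauss_double: "gauss (x @ [a, a] @ y) \<longleftrightarrow> a \<notin> set (x @ y) \<and> gauss (x @ y)"
proof -
  have "gauss (x @ [a, a] @ y) \<longleftrightarrow> gauss (a # a # x @ y)"
    by (rule iffI; erule gauss_cong) auto
  then show ?thesis by (simp only: gauss_Cons_Cons)
qed

lemma gauss_double2:
  "gauss (x @ [a, b] @ y @ [b, a] @ z) \<longleftrightarrow>
     a \<noteq> b \<and> a \<notin> set (x @ y @ z) \<and> b \<notin> set (x @ y @ z) \<and> gauss (x @ y @ z)"
proof -
  have "gauss (x @ [a, b] @ y @ [b, a] @ z) \<longleftrightarrow> gauss (a # a # b # b # x @ y @ z)"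
    by (rule iffI; erule gauss_cong) auto
  then show ?thesis by (auto simp only: gauss_Cons_Cons list.set)
qed

lemma is_nanoword_iff: "is_nanoword (set w, p, w) = gauss w"
  by (simp add: is_nanoword_def gauss_def)

lemma nw_move_homotopic: "nw_move \<tau> X Y \<Longrightarrow> nw_homotopic \<tau> X Y"
  unfolding nw_homotopic_def by auto

lemma nw_homotopic_refl: "nw_homotopic \<tau> X X"
  by (simp add: nw_homotopic_def)

lemma nw_homotopic_sym: "nw_homotopic \<tau> X Y \<Longrightarrow> nw_homotopic \<tau> Y X"
  unfolding nw_homotopic_def by (rule sympD[OF symp_rtranclp]) (auto simp: symp_def)

lemma nw_homotopic_trans: "nw_homotopic \<tau> X Y \<Longrightarrow> nw_homotopic \<tau> Y Z \<Longrightarrow> nw_homotopic \<tau> X Z"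
  unfolding nw_homotopic_def by auto

lemma heq_sym: "heq \<tau> v w \<Longrightarrow> heq \<tau> w v"
  by (simp add: heq_def nw_homotopic_sym)

lemma heq_trans [trans]: "heq \<tau> u v \<Longrightarrow> heq \<tau> v w \<Longrightarrow> heq \<tau> u w"
  unfolding heq_def using nw_homotopic_trans by blast

lemma heq_gauss: "heq \<tau> v w \<Longrightarrow> gauss w"
  by (simp add: heq_def)

lemma heq_rename:
  assumes "gauss w" "inj_on f (set w)" "\<forall>l\<in>set w. fst (f l) = fst l"
  shows "heq \<tau> w (map f w)"
proof -
  have "count_list (map f w) (f l) = count_list w l" if "l \<in> set w" for l
    using assms(2) that
    by (simp add: count_list_eq_length_filter filter_map comp_def)
       (metis (mono_tags, lifting) filter_cong inj_onD)
  then have "gauss (map f w)" using assms(1) by (auto simp: gauss_def)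
  moreover have "nw_move \<tau> (set w, fst, w) (f ` set w, fst, map f w)"
    using assms by (intro nw_move.iso) (auto simp: is_nanoword_iff bij_betw_def)
  ultimately show ?thesis
    using assms(1) by (simp add: heq_def word_nw_def nw_move_homotopic)
qed

lemma heq_move1:
  assumes "gauss (x @ [a, a] @ y)"
  shows "heq \<tau> (x @ [a, a] @ y) (x @ y)"
proof -
  have "set (x @ [a, a] @ y) - {a} = set (x @ y)"
    using assms unfolding gauss_double by auto
  then have "nw_move \<tau> (set (x @ [a, a] @ y), fst, x @ [a, a] @ y) (set (x @ y), fst, x @ y)"
    using nw_move.move1[of "set (x @ [a, a] @ y)" fst x a y \<tau>] assms by (simp only: is_nanoword_iff)
  moreover have "gauss (x @ y)" using assms by (simp only: gauss_double)
  ultimately show ?thesis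
    using assms by (simp add: heq_def word_nw_def nw_move_homotopic)
qed

lemma heq_move2:
  assumes "gauss (x @ [a, b] @ y @ [b, a] @ z)" "fst b = \<tau> (fst a)"
  shows "heq \<tau> (x @ [a, b] @ y @ [b, a] @ z) (x @ y @ z)"
proof -
  let ?v = "x @ [a, b] @ y @ [b, a] @ z"
  have g: "a \<noteq> b" "a \<notin> set (x @ y @ z)" "b \<notin> set (x @ y @ z)" "gauss (x @ y @ z)"
    using assms(1) by (simp_all only: gauss_double2 simp_thms)
  then have "set ?v - {a, b} = set (x @ y @ z)" by auto
  then have "nw_move \<tau> (set ?v, fst, ?v) (set (x @ y @ z), fst, x @ y @ z)"
    using nw_move.move2[of "set ?v" fst x a b y z \<tau>] assms g(1)
    by (simp only: is_nanoword_iff simp_thms)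
  with assms(1) g(4) show ?thesis by (simp add: heq_def word_nw_def nw_move_homotopic)
qed

lemma heq_insert2:
  assumes "gauss (x @ y @ z)" "fst b = \<tau> (fst a)" "b \<noteq> a"
    "a \<notin> set (x @ y @ z)" "b \<notin> set (x @ y @ z)"
  shows "heq \<tau> (x @ y @ z) (x @ [a, b] @ y @ [b, a] @ z)"
  using assms by (intro heq_sym[OF heq_move2]) (auto simp only: gauss_double2)

lemma heq_move3:
  assumes g: "gauss (x @ [a, b] @ y @ [a, c] @ z @ [b, c] @ t)"
    and "fst a = fst b" "fst b = fst c" "distinct [a, b, c]"
  shows "heq \<tau> (x @ [a, b] @ y @ [a, c] @ z @ [b, c] @ t) (x @ [b, a] @ y @ [c, a] @ z @ [c, b] @ t)"
proof -
  let ?v = "x @ [a, b] @ y @ [a, c] @ z @ [b, c] @ t" and ?w = "x @ [b, a] @ y @ [c, a] @ z @ [c, b] @ t"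
  have "gauss ?w" using g by (rule gauss_cong) simp
  have "set ?w = set ?v" by auto
  then have "nw_move \<tau> (set ?v, fst, ?v) (set ?w, fst, ?w)"
    using nw_move.move3[of "set ?v" fst x a b y c z t \<tau>] assms
    by (simp only: is_nanoword_iff distinct.simps list.set) simp
  with g \<open>gauss ?w\<close> show ?thesis by (simp only: heq_def word_nw_def nw_move_homotopic)
qed

lemma heq_move3_inverse:
  assumes g: "gauss (x @ [b, a] @ y @ [c, a] @ z @ [c, b] @ t)"
    and "fst a = fst b" "fst b = fst c" "distinct [b, a, c]"
  shows "heq \<tau> (x @ [b, a] @ y @ [c, a] @ z @ [c, b] @ t) (x @ [a, b] @ y @ [a, c] @ z @ [b, c] @ t)"
proof (rule heq_sym[OF heq_move3[OF _ assms(2,3)]])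
  show "gauss (x @ [a, b] @ y @ [a, c] @ z @ [b, c] @ t)" using g by (rule gauss_cong) simp
  show "distinct [a, b, c]" using assms(4) by auto
qed

text \<open>The index pairs supply infinitely many letters over each \<open>a\<close>; inserted
  auxiliary letters are taken from here.\<close>

lemma ex_fresh_letter:
  fixes X :: "('a \<times> nat \<times> nat) set"
  assumes "finite X"
  obtains l where "l \<notin> X" "fst l = a"
proof -
  have "infinite (range (\<lambda>n::nat. (a, n, 0::nat)))"
    by (auto simp: inj_on_def finite_image_iff)
  then obtain n where "(a, n, 0) \<notin> X" using assms by (meson finite_subset image_subsetI)
  then show ?thesis using that[of "(a, n, 0)"] by simp
qed

lemma heq_move2_parallel:
  fixes x y z :: "('a \<times> nat \<times> nat) list"
  assumes g: "gauss (x @ [a, b] @ y @ [a, b] @ z)" and b: "fst b = \<tau> (fst a)" and ab: "a \<noteq> b"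
    and inv: "\<forall>x. \<tau> (\<tau> x) = x"
  shows "heq \<tau> (x @ [a, b] @ y @ [a, b] @ z) (x @ y @ z)"
proof -
  let ?w = "x @ [a, b] @ y @ z"
  \<comment> \<open>The auxiliary letters \<open>e\<close>, \<open>k\<close> lie over the projection
    of \<open>a\<close>, and \<open>f\<close>, \<open>h\<close> over that of
    \<open>b\<close>.\<close>
  obtain e where e: "e \<notin> set ?w" "fst e = fst a" by (rule ex_fresh_letter[OF finite_set])
  obtain f where f: "f \<notin> set (e # ?w)" "fst f = fst b" by (rule ex_fresh_letter[OF finite_set])
  obtain k where k: "k \<notin> set (e # f # ?w)" "fst k = fst a" by (rule ex_fresh_letter[OF finite_set])
  obtain h where h: "h \<notin> set (e # f # k # ?w)" "fst h = fst b" by (rule ex_fresh_letter[OF finite_set])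
  have ha: "fst a = \<tau> (fst h)" using b h inv by simp
  have fe: "fst f = \<tau> (fst e)" "fst h = \<tau> (fst k)" "fst b = \<tau> (fst k)" using b e f h k by simp_all
  have fb: "fst h = fst f" "fst f = fst b" using f h by simp_all
  have "heq \<tau> (x @ [a, b] @ y @ [a, b] @ z) (x @ [e, f, a, b, f, e] @ y @ [a, b] @ z)"
    using heq_insert2[of x "[a, b]" "y @ [a, b] @ z" f \<tau> e] g e(1) f(1) fe(1) by simp
  also have "heq \<tau> \<dots> (x @ [e, k, h, f, a, b, f, e] @ y @ [a, b, h, k] @ z)"
    using heq_insert2[of "x @ [e]" "[f, a, b, f, e] @ y @ [a, b]" z h \<tau> k] heq_gauss[OF calculation]
      e(1) f(1) h(1) k(1) fe(2) by simp
  \<comment> \<open>The two insertions have produced the pattern of the inverse third move for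
    \<open>h\<close>, \<open>f\<close>, \<open>b\<close>, which share one projection. Afterwards
    \<open>h a ... a h\<close> is a nested pair, its removal leaves \<open>f f\<close>, and then
    \<open>k b ... b k\<close> cancels and \<open>e e\<close> remains.\<close>
  also have "heq \<tau> \<dots> (x @ [e, k, f, h, a, f, b, e] @ y @ [a, h, b, k] @ z)"
    using heq_move3_inverse[of "x @ [e, k]" h f "[a]" b "e # y @ [a]" "k # z" \<tau>] heq_gauss[OF calculation]
      f(1) h(1) fb ab by simp
  also have "heq \<tau> \<dots> (x @ [e, k, f, f, b, e] @ y @ [b, k] @ z)"
    using heq_move2[of "x @ [e, k, f]" h a "[f, b, e] @ y" "[b, k] @ z" \<tau>] heq_gauss[OF calculation]
      ha by simp
  also have "heq \<tau> \<dots> (x @ [e, k, b, e] @ y @ [b, k] @ z)"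
    using heq_move1[of "x @ [e, k]" f "[b, e] @ y @ [b, k] @ z" \<tau>] heq_gauss[OF calculation] by simp
  also have "heq \<tau> \<dots> (x @ [e, e] @ y @ z)"
    using heq_move2[of "x @ [e]" k b "[e] @ y" z \<tau>] heq_gauss[OF calculation] fe(3) by simp
  also have "heq \<tau> \<dots> (x @ y @ z)"
    using heq_move1[of x e "y @ z" \<tau>] heq_gauss[OF calculation] by simp
  finally show ?thesis .
qed

section \<open>Desingularized words\<close>

lemma ex_occurrence:
  assumes "1 \<le> j" "j \<le> count_list w a"
  shows "\<exists>k<length w. w ! k = a \<and> count_list (take (Suc k) w) a = j"
  using assms
proof (induction w rule: rev_induct)
  case (snoc x w)
  show ?case
  proof (cases "j \<le> count_list w a")
    case True
    then obtain k where "k < length w" "w ! k = a" "count_list (take (Suc k) w) a = j"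
      using snoc by blast
    then show ?thesis by (intro exI[of _ k]) (simp add: nth_append)
  next
    case False
    then have "x = a" "j = Suc (count_list w a)" using snoc.prems by (auto split: if_splits)
    then show ?thesis by (intro exI[of _ "length w"]) simp
  qed
qed simp

text \<open>The letter \<open>(a, i, j)\<close> is emitted at the \<open>j\<close>-th occurrence of
  \<open>a\<close>. Hence the alphabet of a desingularization is the set of its letters, as the form
  \<open>word_nw\<close> requires.\<close>

lemma set_desing_word:
  "set (desing_word w) = {(a, i, j). 1 \<le> i \<and> i < j \<and> j \<le> count_list w a}"
proof (intro equalityI subsetI)
  fix l assume "l \<in> set (desing_word w)"
  then obtain k where k: "k < length w" and l: "l \<in> (\<lambda>i. (w ! k, i, count_list (take (Suc k) w) (w ! k))) `
        {1..<count_list (take (Suc k) w) (w ! k)} \<union>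
      (\<lambda>j. (w ! k, count_list (take (Suc k) w) (w ! k), j)) `
        {Suc (count_list (take (Suc k) w) (w ! k))..<Suc (count_list w (w ! k))}"
    by (auto simp: desing_word_def Let_def)
  have "count_list (take (Suc k) w) (w ! k) + count_list (drop (Suc k) w) (w ! k) = count_list w (w ! k)"
    by (metis append_take_drop_id count_list_append)
  moreover have "count_list (take (Suc k) w) (w ! k) \<noteq> 0"
    using k by (simp add: count_list_0_iff take_Suc_conv_app_nth)
  ultimately show "l \<in> {(a, i, j). 1 \<le> i \<and> i < j \<and> j \<le> count_list w a}" using l by auto
next
  fix l assume "l \<in> {(a, i, j). 1 \<le> i \<and> i < j \<and> j \<le> count_list w a}"
  then obtain a i j where l: "l = (a, i, j)" and ij: "1 \<le> i" "i < j" "j \<le> count_list w a" by auto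
  then obtain k where "k < length w" "w ! k = a" "count_list (take (Suc k) w) a = j"
    using ex_occurrence[of j w a] by auto
  then show "l \<in> set (desing_word w)"
    using ij by (auto simp: l desing_word_def Let_def intro!: bexI[of _ k])
qed

lemma desing_word_nw: "desing (UNIV, id, w) = word_nw (desing_word w)"
  by (auto simp: desing_def word_nw_def set_desing_word)

lemma word_homotopic_iff:
  "word_homotopic \<tau> u v \<longleftrightarrow> nw_homotopic \<tau> (word_nw (desing_word u)) (word_nw (desing_word v))"
  by (simp add: word_homotopic_def desing_word_nw)

lemma contractible_iff: "contractible \<tau> w \<longleftrightarrow> word_homotopic \<tau> w []"
  by (simp add: contractible_def word_homotopic_iff desing_word_nw) (simp add: word_nw_def desing_word_def)

lemma word_homotopicI: "heq \<tau> (desing_word u) (desing_word v) \<Longrightarrow> word_homotopic \<tau> u v"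
  by (simp add: word_homotopic_iff heq_def)

lemma word_homotopic_refl: "word_homotopic \<tau> u u"
  by (simp add: word_homotopic_def nw_homotopic_refl)

lemma word_homotopic_sym: "word_homotopic \<tau> u v \<Longrightarrow> word_homotopic \<tau> v u"
  by (simp add: word_homotopic_def nw_homotopic_sym)

lemma word_homotopic_trans: "word_homotopic \<tau> u v \<Longrightarrow> word_homotopic \<tau> v w \<Longrightarrow> word_homotopic \<tau> u w"
  unfolding word_homotopic_def by (rule nw_homotopic_trans)

lemmas desing_word_eval = desing_word_def Let_def numeral_eq_Suc

lemma desing_word_Nil: "desing_word [] = []"
  by (simp add: desing_word_def)

lemma desing_word_aaa:
  "desing_word [a, a, a] = [(a,1,2), (a,1,3), (a,1,2), (a,2,3), (a,1,3), (a,2,3)]"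
  by (simp add: desing_word_eval)

lemma desing_word_five:
  assumes "a \<noteq> b"
  shows
  "desing_word [a, a, a, b, b] = [(a,1,2), (a,1,3), (a,1,2), (a,2,3), (a,1,3), (a,2,3), (b,1,2), (b,1,2)]"
  "desing_word [a, a, b, b, a] = [(a,1,2), (a,1,3), (a,1,2), (a,2,3), (b,1,2), (b,1,2), (a,1,3), (a,2,3)]"
  "desing_word [a, b, b, a, a] = [(a,1,2), (a,1,3), (b,1,2), (b,1,2), (a,1,2), (a,2,3), (a,1,3), (a,2,3)]"
  "desing_word [b, b, a, a, a] = [(b,1,2), (b,1,2), (a,1,2), (a,1,3), (a,1,2), (a,2,3), (a,1,3), (a,2,3)]"
  "desing_word [a, b, a, a, b] = [(a,1,2), (a,1,3), (b,1,2), (a,1,2), (a,2,3), (a,1,3), (a,2,3), (b,1,2)]"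
  "desing_word [b, a, a, b, a] = [(b,1,2), (a,1,2), (a,1,3), (a,1,2), (a,2,3), (b,1,2), (a,1,3), (a,2,3)]"
  "desing_word [a, a, b, a, b] = [(a,1,2), (a,1,3), (a,1,2), (a,2,3), (b,1,2), (a,1,3), (a,2,3), (b,1,2)]"
  "desing_word [b, a, b, a, a] = [(b,1,2), (a,1,2), (a,1,3), (b,1,2), (a,1,2), (a,2,3), (a,1,3), (a,2,3)]"
  "desing_word [b, a, a, a, b] = [(b,1,2), (a,1,2), (a,1,3), (a,1,2), (a,2,3), (a,1,3), (a,2,3), (b,1,2)]"
  "desing_word [a, b, a, b, a] = [(a,1,2), (a,1,3), (b,1,2), (a,1,2), (a,2,3), (b,1,2), (a,1,3), (a,2,3)]"
  using assms assms[symmetric] by (simp_all add: desing_word_eval)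

lemma desing_word_aaaa:
  "desing_word [a, a, a, a] = [(a,1,2), (a,1,3), (a,1,4), (a,1,2), (a,2,3), (a,2,4),
     (a,1,3), (a,2,3), (a,3,4), (a,1,4), (a,2,4), (a,3,4)]"
  by (simp add: desing_word_eval)

lemma desing_word_aaaaa:
  "desing_word [a, a, a, a, a] = [(a,1,2), (a,1,3), (a,1,4), (a,1,5), (a,1,2), (a,2,3), (a,2,4), (a,2,5),
     (a,1,3), (a,2,3), (a,3,4), (a,3,5), (a,1,4), (a,2,4), (a,3,4), (a,4,5),
     (a,1,5), (a,2,5), (a,3,5), (a,4,5)]"
  by (simp add: desing_word_eval)

text \<open>Letters of multiplicity one vanish under desingularization, so only equality patterns in
  which every letter recurs remain.\<close>

lemma desing_word_short:
  assumes "length v \<le> 4"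
  obtains "desing_word v = []"
  | c where "desing_word v = desing_word [c, c]"
  | c where "desing_word v = desing_word [c, c, c]"
  | c where "desing_word v = desing_word [c, c, c, c]"
  | c d where "c \<noteq> d" "desing_word v = desing_word [c, c, d, d]"
  | c d where "c \<noteq> d" "desing_word v = desing_word [c, d, d, c]"
  | c d where "c \<noteq> d" "desing_word v = desing_word [c, d, c, d]"
proof -
  have "length v = 0 \<or> length v = 1 \<or> length v = 2 \<or> length v = 3 \<or> length v = 4"
    using assms by linarith
  then consider "v = []" | p where "v = [p]" | p q where "v = [p, q]" | p q r where "v = [p, q, r]"
    | p q r s where "v = [p, q, r, s]"
    by (auto simp: numeral_eq_Suc length_Suc_conv)
  then show ?thesis
  proof cases
    case 1 then show ?thesis by (intro that(1)) (simp add: desing_word_eval)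
  next
    case (2 p) then show ?thesis by (intro that(1)) (simp add: desing_word_eval)
  next
    case (3 p q)
    show ?thesis
    proof (cases "p = q")
      case True with 3 show ?thesis by (intro that(2)[of p]) (auto simp: desing_word_eval)
    next
      case False with 3 show ?thesis by (intro that(1)) (auto simp: desing_word_eval)
    qed
  next
    case (4 p q r)
    note v = this
    consider "q = p" "r = p" | "p \<noteq> r" "q = p" | "p \<noteq> q" "r = p" | "p \<noteq> q" "r = q" | "distinct [p, q, r]"
      by (metis distinct_length_2_or_more distinct_singleton)
    then show ?thesis
    proof cases
      case 1 with v show ?thesis by (intro that(3)[of p]) (auto simp: desing_word_eval)
    next
      case 2 with v show ?thesis by (intro that(2)[of p]) (auto simp: desing_word_eval)
    next
      case 3 with v show ?thesis by (intro that(2)[of p]) (auto simp: desing_word_eval)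
    next
      case 4 with v show ?thesis by (intro that(2)[of q]) (auto simp: desing_word_eval)
    next
      case 5 with v show ?thesis by (intro that(1)) (auto simp: desing_word_eval)
    qed
  next
    case (5 p q r s)
    note v = this
    \<comment> \<open>These are the fifteen set partitions of the four positions.\<close>
    consider "q = p" "r = p" "s = p"
      | "p \<noteq> s" "q = p" "r = p" | "p \<noteq> r" "q = p" "s = p" | "p \<noteq> q" "r = p" "s = p" | "p \<noteq> q" "r = q" "s = q"
      | "p \<noteq> r" "q = p" "s = r" | "p \<noteq> q" "r = q" "s = p" | "p \<noteq> q" "r = p" "s = q"
      | "distinct [p, r, s]" "q = p" | "distinct [p, q, s]" "r = p" | "distinct [p, q, r]" "s = p"
      | "distinct [p, q, s]" "r = q" | "distinct [p, q, r]" "s = q" | "distinct [p, q, r]" "s = r"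
      | "distinct [p, q, r, s]"
      by (metis distinct_length_2_or_more distinct_singleton)
    then show ?thesis
    proof cases
      case 1 with v show ?thesis by (intro that(4)[of p]) simp
    next
      case 6 with v show ?thesis by (intro that(5)[of p r]) simp_all
    next
      case 7 with v show ?thesis by (intro that(6)[of p q]) simp_all
    next
      case 8 with v show ?thesis by (intro that(7)[of p q]) simp_all
    next
      case 2 with v show ?thesis by (intro that(3)[of p]) (simp add: desing_word_eval)
    next
      case 3 with v show ?thesis by (intro that(3)[of p]) (simp add: desing_word_eval)
    next
      case 4 with v show ?thesis by (intro that(3)[of p]) (simp add: desing_word_eval)
    next
      case 5 with v show ?thesis by (intro that(3)[of q]) (simp add: desing_word_eval)
    next
      case 9 with v show ?thesis by (intro that(2)[of p]) (auto simp: desing_word_eval)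
    next
      case 10 with v show ?thesis by (intro that(2)[of p]) (auto simp: desing_word_eval)
    next
      case 11 with v show ?thesis by (intro that(2)[of p]) (auto simp: desing_word_eval)
    next
      case 12 with v show ?thesis by (intro that(2)[of q]) (auto simp: desing_word_eval)
    next
      case 13 with v show ?thesis by (intro that(2)[of q]) (auto simp: desing_word_eval)
    next
      case 14 with v show ?thesis by (intro that(2)[of r]) (auto simp: desing_word_eval)
    next
      case 15 with v show ?thesis by (intro that(1)) (auto simp: desing_word_eval)
    qed
  qed
qed

section \<open>Explicit homotopies and contractions of words\<close>

lemma typeI_homotopic_aaa:
  assumes "a \<noteq> b" "w \<in> typeI_words a b"
  shows "word_homotopic \<tau> w [a, a, a]"
proof -
  let ?B = "(b, 1::nat, 2::nat)"
  let ?x = "[(a,1,2), (a,1,3), (a,1,2), (a,2,3), (a,1,3), (a,2,3)] :: ('a \<times> nat \<times> nat) list"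
  have "heq \<tau> (take k ?x @ [?B, ?B] @ drop k ?x) (take k ?x @ drop k ?x)" for k
  proof (rule heq_move1)
    have "gauss (take k ?x @ drop k ?x)" by (simp only: append_take_drop_id) (simp add: gauss_def)
    moreover have "?B \<notin> set (take k ?x @ drop k ?x)"
      using assms(1) by (simp only: append_take_drop_id) simp
    ultimately show "gauss (take k ?x @ [?B, ?B] @ drop k ?x)" by (simp only: gauss_double simp_thms)
  qed
  \<comment> \<open>Each \<open>a\<close> contributes two letters to \<open>?x\<close>, so a block
    \<open>bb\<close> preceded by 0, 1, 2 or 3 letters \<open>a\<close> sits at these even
    positions.\<close>
  from this[of 0] this[of 2] this[of 4] this[of 6] show ?thesis
    using assms by (intro word_homotopicI) (auto simp: typeI_words_def desing_word_five desing_word_aaa)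
qed

text \<open>A third move creates the parallel pair \<open>PRPR\<close>, which cancels because the
  common projection is its own image under \<open>\<tau>\<close>; then \<open>QQ\<close> is left.
  The context \<open>x\<close>, \<open>y\<close> allows use inside longer words.\<close>

lemma heq_contract_aaa:
  fixes P Q R :: "'a \<times> nat \<times> nat"
  assumes g: "gauss (x @ [P, Q, P, R, Q, R] @ y)" and PQR: "distinct [P, Q, R]" "fst Q = fst P" "fst R = fst P"
    and inv: "\<forall>x. \<tau> (\<tau> x) = x" and fixed: "\<tau> (fst P) = fst P"
  shows "heq \<tau> (x @ [P, Q, P, R, Q, R] @ y) (x @ y)"
proof -
  have "heq \<tau> (x @ [P, Q, P, R, Q, R] @ y) (x @ [Q, P, R, P, R, Q] @ y)"
    using heq_move3[of x P Q "[]" R "[]" y \<tau>] g PQR by simp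
  also have "heq \<tau> \<dots> (x @ [Q, Q] @ y)"
    using heq_move2_parallel[of "x @ [Q]" P R "[]" "Q # y" \<tau>] heq_gauss[OF calculation] PQR fixed inv by simp
  also have "heq \<tau> \<dots> (x @ y)"
    using heq_move1[of x Q y \<tau>] heq_gauss[OF calculation] by simp
  finally show ?thesis .
qed

context
  fixes \<tau> :: "'a \<Rightarrow> 'a"
  assumes inv: "\<forall>x. \<tau> (\<tau> x) = x"
begin

lemma contractible_aaa: "\<tau> a = a \<Longrightarrow> contractible \<tau> [a, a, a]"
  using heq_contract_aaa[of "[]" "(a,1,2)" "(a,1,3)" "(a,2,3)" "[]" \<tau>] inv
  by (auto intro!: word_homotopicI simp: contractible_iff desing_word_aaa gauss_def desing_word_Nil)

lemma contractible_baaab: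
  assumes "\<tau> a = a" "a \<noteq> b"
  shows "contractible \<tau> [b, a, a, a, b]"
proof -
  let ?B = "(b, 1, 2) :: 'a \<times> nat \<times> nat"
  have "heq \<tau> (desing_word [b, a, a, a, b]) [?B, ?B]"
    using heq_contract_aaa[of "[?B]" "(a,1,2)" "(a,1,3)" "(a,2,3)" "[?B]" \<tau>] inv assms
    by (simp add: desing_word_five gauss_def)
  also have "heq \<tau> \<dots> []"
    using heq_move1[of "[]" ?B "[]" \<tau>] by (simp add: gauss_def)
  finally show ?thesis
    by (auto intro!: word_homotopicI simp: contractible_iff desing_word_Nil)
qed

lemma contractible_ababa:
  assumes "\<tau> a = b" "a \<noteq> b"
  shows "contractible \<tau> [a, b, a, b, a]"
proof -
  let ?P = "(a, 1, 2) :: 'a \<times> nat \<times> nat" and ?R = "(a, 2, 3) :: 'a \<times> nat \<times> nat"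
  have "\<tau> b = a" using inv assms by auto
  then have "heq \<tau> (desing_word [a, b, a, b, a]) [?P, ?P, ?R, ?R]"
    using heq_move2[of "[?P]" "(a,1,3)" "(b,1,2)" "[?P, ?R]" "[?R]" \<tau>] assms
    by (simp add: desing_word_five gauss_def)
  also have "heq \<tau> \<dots> [?P, ?P]"
    using heq_move1[of "[?P, ?P]" ?R "[]" \<tau>] by (simp add: gauss_def)
  also have "heq \<tau> \<dots> []"
    using heq_move1[of "[]" ?P "[]" \<tau>] by (simp add: gauss_def)
  finally show ?thesis
    by (auto intro!: word_homotopicI simp: contractible_iff desing_word_Nil)
qed

text \<open>All three desingularizations reduce to the same Gauss word of shape \<open>XYXY\<close>
  with both letters over \<open>a\<close>, because \<open>B\<close> cancels against one of the
  letters over \<open>a\<close>.\<close>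

lemma homotopic_exception:
  assumes "\<tau> a = b" "a \<noteq> b"
  shows "word_homotopic \<tau> [b, a, a, a, b] [a, a, b, a, b]" "word_homotopic \<tau> [b, a, a, a, b] [b, a, b, a, a]"
proof -
  define P Q R B :: "'a \<times> nat \<times> nat" where d: "P = (a,1,2)" "Q = (a,1,3)" "R = (a,2,3)" "B = (b,1,2)"
  have [simp]: "P \<noteq> Q" "P \<noteq> R" "P \<noteq> B" "Q \<noteq> P" "Q \<noteq> R" "Q \<noteq> B" "R \<noteq> P" "R \<noteq> Q" "R \<noteq> B" "B \<noteq> P" "B \<noteq> Q" "B \<noteq> R"
    and f: "fst P = a" "fst Q = a" "fst R = a" "fst B = b" using assms by (auto simp: d)
  have ba: "\<tau> b = a" using inv assms by auto
  have "heq \<tau> [B,P,Q,P,R,Q,R,B] [B,Q,P,R,P,R,Q,B]"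
    using heq_move3[of "[B]" P Q "[]" R "[]" "[B]" \<tau>] by (simp add: gauss_def f)
  also have "heq \<tau> \<dots> [P,R,P,R]"
    using heq_move2[of "[]" B Q "[P,R,P,R]" "[]" \<tau>] ba by (simp add: gauss_def f)
  finally have 1: "heq \<tau> (desing_word [b, a, a, a, b]) [P,R,P,R]"
    using assms by (simp add: desing_word_five d)
  have "heq \<tau> [P,Q,P,R,B,Q,R,B] [P,Q,P,Q]"
    using heq_move2_parallel[of "[P,Q,P]" R B "[Q]" "[]" \<tau>] assms inv by (simp add: gauss_def f)
  moreover have "heq \<tau> [P,Q,P,Q] [P,R,P,R]"
    using heq_rename[of "[P,Q,P,Q]" "id(Q := R)" \<tau>] by (simp add: gauss_def f)
  moreover have "heq \<tau> [B,P,Q,B,P,R,Q,R] [Q,R,Q,R]"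
    using heq_move2_parallel[of "[]" B P "[Q]" "[R,Q,R]" \<tau>] ba inv by (simp add: gauss_def f)
  moreover have "heq \<tau> [Q,R,Q,R] [P,R,P,R]"
    using heq_rename[of "[Q,R,Q,R]" "id(Q := P)" \<tau>] by (simp add: gauss_def f)
  ultimately have "heq \<tau> [P,Q,P,R,B,Q,R,B] [P,R,P,R]" "heq \<tau> [B,P,Q,B,P,R,Q,R] [P,R,P,R]"
    by (blast intro: heq_trans)+
  then have 2: "heq \<tau> (desing_word [a, a, b, a, b]) [P,R,P,R]" "heq \<tau> (desing_word [b, a, b, a, a]) [P,R,P,R]"
    using assms by (simp_all add: desing_word_five d)
  show "word_homotopic \<tau> [b, a, a, a, b] [a, a, b, a, b]" "word_homotopic \<tau> [b, a, a, a, b] [b, a, b, a, a]"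
    by (blast intro: word_homotopicI heq_trans[OF 1] heq_sym[OF 2(1)] heq_sym[OF 2(2)])+
qed

text \<open>Third moves slide \<open>A\<close>, \<open>B\<close> and \<open>C\<close> in turn until
  the parallel pairs \<open>AE\<close>, \<open>BF\<close> and \<open>CG\<close> appear and cancel.
  What remains is the pattern of \<open>aaa\<close> enclosed by the letter \<open>D\<close>.\<close>

lemma contractible_aaaaa:
  assumes "\<tau> a = a"
  shows "contractible \<tau> [a, a, a, a, a]"
proof -
  \<comment> \<open>\<open>A\<close> to \<open>J\<close> name the letters in lexicographic order of
    their index pairs, from (1,2) to (4,5).\<close>
  have "\<exists>A B C D E F G H I J :: 'a \<times> nat \<times> nat.
      desing_word [a, a, a, a, a] = [A,B,C,D,A,E,F,G,B,E,H,I,C,F,H,J,D,G,I,J] \<and>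
      distinct [A,B,C,D,E,F,G,H,I,J] \<and> (\<forall>l\<in>{A,B,C,D,E,F,G,H,I,J}. fst l = a)"
    by (intro exI conjI, rule desing_word_aaaaa) simp_all
  then obtain A B C D E F G H I J :: "'a \<times> nat \<times> nat" where
    w: "desing_word [a, a, a, a, a] = [A,B,C,D,A,E,F,G,B,E,H,I,C,F,H,J,D,G,I,J]"
    and "distinct [A,B,C,D,E,F,G,H,I,J]" and f: "\<forall>l\<in>{A,B,C,D,E,F,G,H,I,J}. fst l = a" by blast
  then have d: "distinct [A,B,C,D,E,F,G,H,I,J]" "distinct (rev [A,B,C,D,E,F,G,H,I,J])"
    by (simp_all only: distinct_rev)
  have g: "gauss [A,B,C,D,A,E,F,G,B,E,H,I,C,F,H,J,D,G,I,J]"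
    using d by (simp add: gauss_def)
  have "heq \<tau> [A,B,C,D,A,E,F,G,B,E,H,I,C,F,H,J,D,G,I,J] [B,A,C,D,E,A,F,G,E,B,H,I,C,F,H,J,D,G,I,J]"
    using heq_move3[of "[]" A B "[C,D]" E "[F,G]" "[H,I,C,F,H,J,D,G,I,J]" \<tau>] g f d by simp
  also have "heq \<tau> \<dots> [B,C,A,D,E,F,A,G,E,B,H,I,F,C,H,J,D,G,I,J]"
    using heq_move3[of "[B]" A C "[D,E]" F "[G,E,B,H,I]" "[H,J,D,G,I,J]" \<tau>] heq_gauss[OF calculation] f d by simp
  also have "heq \<tau> \<dots> [B,C,D,A,E,F,G,A,E,B,H,I,F,C,H,J,G,D,I,J]"
    using heq_move3[of "[B,C]" A D "[E,F]" G "[E,B,H,I,F,C,H,J]" "[I,J]" \<tau>] heq_gauss[OF calculation] f d by simp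
  also have "heq \<tau> \<dots> [B,C,D,F,G,B,H,I,F,C,H,J,G,D,I,J]"
    using heq_move2_parallel[of "[B,C,D]" A E "[F,G]" "[B,H,I,F,C,H,J,G,D,I,J]" \<tau>] heq_gauss[OF calculation] f d inv assms by simp
  also have "heq \<tau> \<dots> [C,B,D,F,G,H,B,I,F,H,C,J,G,D,I,J]"
    using heq_move3[of "[]" B C "[D,F,G]" H "[I,F]" "[J,G,D,I,J]" \<tau>] heq_gauss[OF calculation] f d by simp
  also have "heq \<tau> \<dots> [C,D,B,F,G,H,I,B,F,H,C,J,G,I,D,J]"
    using heq_move3[of "[C]" B D "[F,G,H]" I "[F,H,C,J,G]" "[J]" \<tau>] heq_gauss[OF calculation] f d by simp
  also have "heq \<tau> \<dots> [C,D,G,H,I,H,C,J,G,I,D,J]"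
    using heq_move2_parallel[of "[C,D]" B F "[G,H,I]" "[H,C,J,G,I,D,J]" \<tau>] heq_gauss[OF calculation] f d inv assms by simp
  also have "heq \<tau> \<dots> [D,C,G,H,I,H,J,C,G,I,J,D]"
    using heq_move3[of "[]" C D "[G,H,I,H]" J "[G,I]" "[]" \<tau>] heq_gauss[OF calculation] f d by simp
  also have "heq \<tau> \<dots> [D,H,I,H,J,I,J,D]"
    using heq_move2_parallel[of "[D]" C G "[H,I,H,J]" "[I,J,D]" \<tau>] heq_gauss[OF calculation] f d inv assms by simp
  also have "heq \<tau> \<dots> [D,D]"
    using heq_contract_aaa[of "[D]" H I J "[D]" \<tau>] heq_gauss[OF calculation] f d inv assms by simp
  also have "heq \<tau> \<dots> []"
    using heq_move1[of "[]" D "[]" \<tau>] heq_gauss[OF calculation] by simp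
  finally have "heq \<tau> (desing_word [a, a, a, a, a]) (desing_word [])"
    by (simp add: w desing_word_Nil)
  then show ?thesis by (simp add: contractible_iff word_homotopicI)
qed

end

section \<open>Linear colorings of words\<close>

lemma desing_word_abab:
  "a \<noteq> b \<Longrightarrow> desing_word [a, b, a, b] = [(a,1,2), (b,1,2), (a,1,2), (b,1,2)]"
  using not_sym[of a b] by (simp add: desing_word_eval)

lemmas lin_color_eval = lin_color_def word_color_def nw_step_def desing_word_five desing_word_aaa desing_word_abab
  desing_word_aaaa desing_word_aaaaa

lemma lin_color_cong: "desing_word v = desing_word w \<Longrightarrow> lin_color s f q v = lin_color s f q w"
  by (simp add: lin_color_def word_color_def)

lemma lin_color_Nil: "lin_color s f q [] = q"
  by (simp add: lin_color_def word_color_def desing_word_Nil)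

text \<open>The words of type (II) other than the fifth powers; the first argument is the letter of
  multiplicity three.\<close>

definition forms :: "'a \<Rightarrow> 'a \<Rightarrow> 'a list set" where
  "forms a b = {[a,b,a,a,b], [b,a,a,b,a], [a,a,b,a,b], [b,a,b,a,a], [b,a,a,a,b], [a,b,a,b,a]}"

text \<open>With identity maps for \<open>b\<close>, reading a letter over \<open>b\<close> never
  changes the color, so only the occurrences of \<open>a\<close> count.\<close>

lemma lin_color_trivial_second:
  fixes s f :: "'a \<Rightarrow> 'q::ab_group_add \<Rightarrow> 'q"
  assumes "a \<noteq> b" "\<And>x. s b x = x" "\<And>x. f b x = x" "w \<in> forms a b"
  shows "lin_color s f q w = lin_color s f q [a, a, a]"
  using assms by (auto simp: forms_def lin_color_eval)

text \<open>Here only the two occurrences of \<open>(b,1,2)\<close> act, and the second one undoes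
  the first.\<close>

lemma lin_color_trivial_first:
  fixes s f :: "'a \<Rightarrow> 'q::ab_group_add \<Rightarrow> 'q"
  assumes "a \<noteq> b" "\<And>x. s a x = x" "\<And>x. f a x = x" "w \<in> forms a b"
  shows "lin_color s f q w = q"
  using assms by (auto simp: forms_def lin_color_eval)

lemma lin_color_trivial:
  fixes s f :: "'a \<Rightarrow> 'q::ab_group_add \<Rightarrow> 'q"
  assumes "\<And>x. s a x = x" "\<And>x. f a x = x"
  shows "lin_color s f q [a, a, a] = q" "lin_color s f q [a, a, a, a] = q" "lin_color s f q [a, a, a, a, a] = q"
  using assms by (simp_all add: lin_color_eval)

lemma lin_color_pairs:
  fixes s f :: "'a \<Rightarrow> 'q::ab_group_add \<Rightarrow> 'q"
  shows "lin_color s f q [c, c] = q"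
    "c \<noteq> d \<Longrightarrow> lin_color s f q [c, c, d, d] = q" "c \<noteq> d \<Longrightarrow> lin_color s f q [c, d, d, c] = q"
  using not_sym[of c d] by (simp_all add: lin_color_def word_color_def nw_step_def desing_word_eval)

section \<open>Rational colorings\<close>

definition rat_color :: "('a \<Rightarrow> rat) \<Rightarrow> ('a \<Rightarrow> rat) \<Rightarrow> 'a list \<Rightarrow> rat" where
  "rat_color \<sigma> \<phi> = lin_color (\<lambda>a x. \<sigma> a * x) (\<lambda>a x. \<phi> a * x) 1"

text \<open>If \<open>\<tau> a = a\<close>, then \<open>wt\<close> is compatible with the involution only for \<open>x * x = 1\<close>, and likewise
  for \<open>b\<close> and \<open>y\<close>. The numerical weights below were found by search so as to separate the words in question.\<close>

definition wt :: "('a \<Rightarrow> 'a) \<Rightarrow> 'a \<Rightarrow> rat \<Rightarrow> 'a \<Rightarrow> rat \<Rightarrow> 'a \<Rightarrow> rat" where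
  "wt \<tau> a x b y c = (if c = a then x else if c = \<tau> a then 1 / x else
     if c = b then y else if c = \<tau> b then 1 / y else 1)"

text \<open>Scalars commute, so all that needs proof is that the weights at \<open>c\<close> and
  \<open>\<tau> c\<close> are mutually inverse.\<close>

lemma rat_color_homotopic:
  assumes inv: "\<forall>x. \<tau> (\<tau> x) = x" and "x \<noteq> 0" "y \<noteq> 0" "x' \<noteq> 0" "y' \<noteq> 0"
    and "\<tau> a = a \<Longrightarrow> x * x = 1 \<and> x' * x' = 1" "\<tau> b = b \<Longrightarrow> y * y = 1 \<and> y' * y' = 1"
    and "word_homotopic \<tau> u v"
  shows "rat_color (wt \<tau> a x b y) (wt \<tau> a x' b y') u = rat_color (wt \<tau> a x b y) (wt \<tau> a x' b y') v"
proof -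
  have *: "wt \<tau> a x b y c * wt \<tau> a x b y (\<tau> c) = 1"
    if "x \<noteq> 0" "y \<noteq> 0" "\<tau> a = a \<Longrightarrow> x * x = 1" "\<tau> b = b \<Longrightarrow> y * y = 1" for c x y
  proof -
    \<comment> \<open>The weights of \<open>b\<close> count only outside the orbit of
      \<open>a\<close>; two orbits are equal or disjoint, so \<open>c\<close> and
      \<open>\<tau> c\<close> always fall under the same pair of weights.\<close>
    consider "c = a" | "c = \<tau> a" "c \<noteq> a" | "c = b" "c \<noteq> a" "c \<noteq> \<tau> a" | "c = \<tau> b" "c \<noteq> a" "c \<noteq> \<tau> a" "c \<noteq> b"
      | "c \<noteq> a" "c \<noteq> \<tau> a" "c \<noteq> b" "c \<noteq> \<tau> b" by blast
    then show ?thesis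
    proof cases
      case 3
      then have "\<tau> b \<noteq> a" "\<tau> b \<noteq> \<tau> a" using inv by metis+
      with 3 that show ?thesis by (auto simp: wt_def)
    next
      case 4
      then have "b \<noteq> a" "b \<noteq> \<tau> a" using inv by metis+
      with 4 that inv show ?thesis by (auto simp: wt_def)
    next
      case 5
      then have "\<tau> c \<noteq> a" "\<tau> c \<noteq> \<tau> a" "\<tau> c \<noteq> b" "\<tau> c \<noteq> \<tau> b" using inv by metis+
      with 5 show ?thesis by (auto simp: wt_def)
    qed (use that inv in \<open>auto simp: wt_def\<close>)
  qed
  have w: "wt \<tau> a x b y c * wt \<tau> a x b y (\<tau> c) = 1"
    and w': "wt \<tau> a x' b y' (\<tau> c) * wt \<tau> a x' b y' c = 1" for c
    using *[of x y c] *[of x' y' c] assms(2-7) by (auto simp: mult.commute)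
  show ?thesis
    unfolding rat_color_def
  proof (rule lin_color_homotopic[OF _ _ _ _ _ assms(8)])
    show "wt \<tau> a x b y c * (wt \<tau> a x b y (\<tau> c) * z) = z" for c z
      by (simp only: mult.assoc[symmetric] w mult_1)
    show "wt \<tau> a x' b y' (\<tau> c) * (wt \<tau> a x' b y' c * z) = z" for c z
      by (simp only: mult.assoc[symmetric] w' mult_1)
  qed (simp_all add: algebra_simps)
qed

text \<open>These weights describe the case \<open>b = \<tau> a\<close>. The common value 11
  reflects the exceptional homotopies, and the value 1 of \<open>ababa\<close> its
  contractibility.\<close>

lemma rat_color_orbit:
  assumes "a \<noteq> b" "\<sigma> a = 3" "\<phi> a = 2" "\<sigma> b = 1/3" "\<phi> b = 1/2"
  shows "rat_color \<sigma> \<phi> [a,b,a,a,b] = -7/3" "rat_color \<sigma> \<phi> [b,a,a,b,a] = -4"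
    "rat_color \<sigma> \<phi> [a,a,b,a,b] = 11" "rat_color \<sigma> \<phi> [b,a,b,a,a] = 11" "rat_color \<sigma> \<phi> [b,a,a,a,b] = 11"
    "rat_color \<sigma> \<phi> [a,b,a,b,a] = 1" "rat_color \<sigma> \<phi> [b,a,b,b,a] = 11/6" "rat_color \<sigma> \<phi> [a,b,b,a,b] = 14/9"
    "rat_color \<sigma> \<phi> [b,b,a,b,a] = 13/18" "rat_color \<sigma> \<phi> [a,b,a,b,b] = 13/18" "rat_color \<sigma> \<phi> [a,b,b,b,a] = 13/18"
    "rat_color \<sigma> \<phi> [b,a,b,a,b] = 1" "rat_color \<sigma> \<phi> [a,b,a,b] = 1" "rat_color \<sigma> \<phi> [b,a,b,a] = 1"
  using assms(1) not_sym[OF assms(1)]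
  by (simp_all add: assms(2-5) rat_color_def lin_color_eval)

lemma rat_color_power:
  assumes "\<sigma> a = 3" "\<phi> a = 2"
  shows "rat_color \<sigma> \<phi> [a,a,a] = 61" "rat_color \<sigma> \<phi> [a,a,a,a] = 26641" "rat_color \<sigma> \<phi> [a,a,a,a,a] = 45778381"
  by (simp_all add: assms rat_color_def lin_color_eval)

lemma rat_color_power_inverse:
  assumes "\<sigma> a = 1/3" "\<phi> a = 1/2"
  shows "rat_color \<sigma> \<phi> [a,a,a] = 103/108" "rat_color \<sigma> \<phi> [a,a,a,a] = 1759/1944"
    "rat_color \<sigma> \<phi> [a,a,a,a,a] = 26381323/30233088"
  by (simp_all add: assms rat_color_def lin_color_eval)

text \<open>The weights 1 and -1 are their own inverses, so they are admissible for any
  \<open>b\<close> and treat \<open>b\<close> and \<open>\<tau> b\<close> alike. The six values are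
  distinct from each other and from the value 61 of \<open>aaa\<close>.\<close>

lemma rat_color_nonfixed:
  assumes "a \<noteq> b" "\<sigma> a = 3" "\<phi> a = 2" "\<sigma> b = 1" "\<phi> b = -1"
  shows "rat_color \<sigma> \<phi> [a,b,a,a,b] = -243" "rat_color \<sigma> \<phi> [b,a,a,b,a] = -43"
    "rat_color \<sigma> \<phi> [a,a,b,a,b] = -163" "rat_color \<sigma> \<phi> [b,a,b,a,a] = 17" "rat_color \<sigma> \<phi> [b,a,a,a,b] = -59"
    "rat_color \<sigma> \<phi> [a,b,a,b,a] = -179"
  using assms(2-5) assms(1) by (simp_all add: rat_color_def lin_color_eval)

text \<open>Here \<open>c\<close> stands for \<open>\<tau> b\<close>, to be told apart from
  \<open>b\<close>. In the first five cases \<open>a\<close> has weights 1 and -1, admissible even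
  for a fixed \<open>a\<close>; \<open>baaab\<close> is contractible for fixed \<open>a\<close>, so
  its weights must be of another kind.\<close>

lemma rat_color_second_letter:
  assumes "a \<noteq> b" "a \<noteq> c" "\<sigma> b = 3" "\<phi> b = 2" "\<sigma> c = 1/3" "\<phi> c = 1/2"
  shows "\<sigma> a = -1 \<Longrightarrow> \<phi> a = 1 \<Longrightarrow> rat_color \<sigma> \<phi> [a,b,a,a,b] \<noteq> rat_color \<sigma> \<phi> [a,c,a,a,c]"
    "\<sigma> a = 1 \<Longrightarrow> \<phi> a = -1 \<Longrightarrow> rat_color \<sigma> \<phi> [b,a,a,b,a] \<noteq> rat_color \<sigma> \<phi> [c,a,a,c,a]"
    "\<sigma> a = 1 \<Longrightarrow> \<phi> a = -1 \<Longrightarrow> rat_color \<sigma> \<phi> [a,a,b,a,b] \<noteq> rat_color \<sigma> \<phi> [a,a,c,a,c]"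
    "\<sigma> a = -1 \<Longrightarrow> \<phi> a = 1 \<Longrightarrow> rat_color \<sigma> \<phi> [b,a,b,a,a] \<noteq> rat_color \<sigma> \<phi> [c,a,c,a,a]"
    "\<sigma> a = -1 \<Longrightarrow> \<phi> a = 1 \<Longrightarrow> rat_color \<sigma> \<phi> [a,b,a,b,a] \<noteq> rat_color \<sigma> \<phi> [a,c,a,c,a]"
    "\<sigma> a = 3 \<Longrightarrow> \<phi> a = 2 \<Longrightarrow> rat_color \<sigma> \<phi> [b,a,a,a,b] \<noteq> rat_color \<sigma> \<phi> [c,a,a,a,c]"
  using assms(1,2) by (simp_all add: assms(3-6) rat_color_def lin_color_eval)

text \<open>For fixed points of \<open>\<tau>\<close> scalar colorings do not separate \<open>ababa\<close> from \<open>babab\<close>; the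
  noncommuting involutions below do. Either of the two colorings alone confuses some of the words.\<close>

definition mat :: "('a \<Rightarrow> 'a) \<Rightarrow> 'a \<Rightarrow> (int \<times> int \<Rightarrow> int \<times> int) \<Rightarrow> 'a \<Rightarrow> (int \<times> int \<Rightarrow> int \<times> int) \<Rightarrow>
    'a \<Rightarrow> int \<times> int \<Rightarrow> int \<times> int" where
  "mat \<tau> a A b B c = (if c = a then A else if c = b \<or> c = \<tau> b then B else (\<lambda>x. x))"

abbreviation "shear \<equiv> (\<lambda>z :: int \<times> int. (- fst z, snd z - fst z))"
abbreviation "flip \<equiv> (\<lambda>z :: int \<times> int. (snd z, fst z))"
abbreviation "negflip \<equiv> (\<lambda>z :: int \<times> int. (- snd z, - fst z))"

text \<open>All maps involved are linear involutions, and at each letter the two maps commute.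
  \<open>color2\<close> arises from \<open>color1\<close> by exchanging the roles of
  \<open>s\<close> and \<open>f\<close>.\<close>

definition color1 :: "('a \<Rightarrow> 'a) \<Rightarrow> 'a \<Rightarrow> 'a \<Rightarrow> 'a list \<Rightarrow> int \<times> int" where
  "color1 \<tau> a b = lin_color (mat \<tau> a shear b negflip) (mat \<tau> a uminus b flip) (1, 0)"

definition color2 :: "('a \<Rightarrow> 'a) \<Rightarrow> 'a \<Rightarrow> 'a \<Rightarrow> 'a list \<Rightarrow> int \<times> int" where
  "color2 \<tau> a b = lin_color (mat \<tau> a uminus b flip) (mat \<tau> a shear b negflip) (1, 0)"

text \<open>\<open>\<tau>\<close> preserves the classes \<open>{a}\<close> and
  \<open>{b, \<tau> b}\<close>, so the maps at \<open>c\<close> and \<open>\<tau> c\<close> coincide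
  and, being involutions, are inverse to each other.\<close>

lemma color12_homotopic:
  assumes inv: "\<forall>x. \<tau> (\<tau> x) = x" and "\<tau> a = a" "a \<noteq> b" and h: "word_homotopic \<tau> u v"
  shows "color1 \<tau> a b u = color1 \<tau> a b v" "color2 \<tau> a b u = color2 \<tau> a b v"
proof -
  have "\<tau> b \<noteq> a" using assms by metis
  then have t: "\<tau> c = a \<longleftrightarrow> c = a" "\<tau> c = \<tau> b \<longleftrightarrow> c = b" "\<tau> c = b \<longleftrightarrow> c = \<tau> b" for c using assms by metis+
  show "color1 \<tau> a b u = color1 \<tau> a b v" unfolding color1_def
    by (rule lin_color_homotopic[OF _ _ _ _ _ h]) (use t in \<open>auto simp: mat_def\<close>)
  show "color2 \<tau> a b u = color2 \<tau> a b v" unfolding color2_def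
    by (rule lin_color_homotopic[OF _ _ _ _ _ h]) (use t in \<open>auto simp: mat_def\<close>)
qed

text \<open>The twelve pairs are pairwise distinct and differ from the initial pair. Words with
  \<open>d\<close> tripled are included for the case that both letters are fixed, and the words of
  length four for the comparison with short words.\<close>

lemma color12_values:
  assumes "a \<noteq> b" "a \<noteq> \<tau> b" "d \<in> {b, \<tau> b}"
  shows
    "(color1 \<tau> a b [a,d,a,a,d], color2 \<tau> a b [a,d,a,a,d]) = ((1, 0), (3, 0))"
    "(color1 \<tau> a b [d,a,a,d,a], color2 \<tau> a b [d,a,a,d,a]) = ((5, 4), (1, 0))"
    "(color1 \<tau> a b [a,a,d,a,d], color2 \<tau> a b [a,a,d,a,d]) = ((3, 2), (1, 0))"
    "(color1 \<tau> a b [d,a,d,a,a], color2 \<tau> a b [d,a,d,a,a]) = ((1, 0), (1, -2))"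
    "(color1 \<tau> a b [a,d,a,d,a], color2 \<tau> a b [a,d,a,d,a]) = ((2, 1), (2, 1))"
    "(color1 \<tau> a b [d,a,d,d,a], color2 \<tau> a b [d,a,d,d,a]) = ((-3, 0), (-1, 2))"
    "(color1 \<tau> a b [a,d,d,a,d], color2 \<tau> a b [a,d,d,a,d]) = ((-3, -2), (-7, -8))"
    "(color1 \<tau> a b [d,d,a,d,a], color2 \<tau> a b [d,d,a,d,a]) = ((-3, -2), (-3, -4))"
    "(color1 \<tau> a b [a,d,a,d,d], color2 \<tau> a b [a,d,a,d,d]) = ((-3, -4), (-1, 2))"
    "(color1 \<tau> a b [d,a,d,a,d], color2 \<tau> a b [d,a,d,a,d]) = ((1, 2), (-1, -2))"
    "(color1 \<tau> a b [a,d,a,d], color2 \<tau> a b [a,d,a,d]) = ((0, 0), (-4, -3))"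
    "(color1 \<tau> a b [d,a,d,a], color2 \<tau> a b [d,a,d,a]) = ((-3, -1), (-1, -2))"
proof -
  have m: "mat \<tau> a A b B a = A" "mat \<tau> a A b B d = B" for A B using assms by (auto simp: mat_def)
  have "a \<noteq> d" "d \<noteq> a" using assms by auto
  then show
    "(color1 \<tau> a b [a,d,a,a,d], color2 \<tau> a b [a,d,a,a,d]) = ((1, 0), (3, 0))"
    "(color1 \<tau> a b [d,a,a,d,a], color2 \<tau> a b [d,a,a,d,a]) = ((5, 4), (1, 0))"
    "(color1 \<tau> a b [a,a,d,a,d], color2 \<tau> a b [a,a,d,a,d]) = ((3, 2), (1, 0))"
    "(color1 \<tau> a b [d,a,d,a,a], color2 \<tau> a b [d,a,d,a,a]) = ((1, 0), (1, -2))"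
    "(color1 \<tau> a b [a,d,a,d,a], color2 \<tau> a b [a,d,a,d,a]) = ((2, 1), (2, 1))"
    "(color1 \<tau> a b [d,a,d,d,a], color2 \<tau> a b [d,a,d,d,a]) = ((-3, 0), (-1, 2))"
    "(color1 \<tau> a b [a,d,d,a,d], color2 \<tau> a b [a,d,d,a,d]) = ((-3, -2), (-7, -8))"
    "(color1 \<tau> a b [d,d,a,d,a], color2 \<tau> a b [d,d,a,d,a]) = ((-3, -2), (-3, -4))"
    "(color1 \<tau> a b [a,d,a,d,d], color2 \<tau> a b [a,d,a,d,d]) = ((-3, -4), (-1, 2))"
    "(color1 \<tau> a b [d,a,d,a,d], color2 \<tau> a b [d,a,d,a,d]) = ((1, 2), (-1, -2))"
    "(color1 \<tau> a b [a,d,a,d], color2 \<tau> a b [a,d,a,d]) = ((0, 0), (-4, -3))"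
    "(color1 \<tau> a b [d,a,d,a], color2 \<tau> a b [d,a,d,a]) = ((-3, -1), (-1, -2))"
    by (simp_all add: color1_def color2_def m lin_color_eval)
qed

lemma color12_power:
  "color1 \<tau> a b [c, c, c] = (1, 0)" "color2 \<tau> a b [c, c, c] = (1, 0)"
  "color1 \<tau> a b [c, c, c, c] = (1, 0)" "color2 \<tau> a b [c, c, c, c] = (1, 0)"
  by (auto simp: color1_def color2_def mat_def lin_color_eval simp flip: zero_prod_def)

lemma color12_abab:
  assumes "a \<noteq> b" "a \<noteq> \<tau> b" "c \<noteq> d"
  shows "(color1 \<tau> a b [c,d,c,d], color2 \<tau> a b [c,d,c,d]) \<in>
    {((1, 0), (1, 0)), ((0, 0), (-4, -3)), ((-3, -1), (-1, -2))}"
proof -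
  consider "c = a" | "d = a" | "c \<noteq> a" "d \<noteq> a" using assms by blast
  then show ?thesis
  proof cases
    case 1
    then show ?thesis
      using assms color12_values(11)[of a b \<tau> d]
      by (cases "d \<in> {b, \<tau> b}") (auto simp: color1_def color2_def mat_def lin_color_eval zero_prod_def)
  next
    case 2
    then show ?thesis
      using assms color12_values(12)[of a b \<tau> c]
      by (cases "c \<in> {b, \<tau> b}") (auto simp: color1_def color2_def mat_def lin_color_eval zero_prod_def)
  next
    case 3
    then show ?thesis
      using assms by (auto simp: color1_def color2_def mat_def lin_color_eval zero_prod_def)
  qed
qed

section \<open>Classification of words of length five\<close>

lemma word_homotopic_cong:
  "desing_word v = desing_word w \<Longrightarrow> word_homotopic \<tau> u v \<longleftrightarrow> word_homotopic \<tau> u w"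
  by (simp add: word_homotopic_iff)

lemma homotopic_contractible:
  "word_homotopic \<tau> u v \<Longrightarrow> contractible \<tau> v \<Longrightarrow> contractible \<tau> u"
  unfolding contractible_iff by (rule word_homotopic_trans)

context
  fixes \<tau> :: "'a \<Rightarrow> 'a"
  assumes inv: "\<forall>x. \<tau> (\<tau> x) = x"
begin

section \<open>Colorings supported on one orbit of two letters\<close>

definition orbit_color :: "'a \<Rightarrow> 'a list \<Rightarrow> rat" where
  "orbit_color x = rat_color (wt \<tau> x 3 x 1) (wt \<tau> x 2 x 1)"

lemma orbit_color_homotopic:
  "\<tau> x \<noteq> x \<Longrightarrow> word_homotopic \<tau> u v \<Longrightarrow> orbit_color x u = orbit_color x v"
  unfolding orbit_color_def by (rule rat_color_homotopic[OF inv]) simp_all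

lemma orbit_color_Nil: "orbit_color x [] = 1"
  by (simp add: orbit_color_def rat_color_def lin_color_Nil)

lemma wt_simps:
  "\<tau> x \<noteq> x \<Longrightarrow> wt \<tau> x r x 1 x = r" "\<tau> x \<noteq> x \<Longrightarrow> wt \<tau> x r x 1 (\<tau> x) = 1 / r"
  "c \<noteq> x \<Longrightarrow> c \<noteq> \<tau> x \<Longrightarrow> wt \<tau> x r x 1 c = 1"
  by (auto simp: wt_def)

lemma orbit_color_power:
  assumes "\<tau> x \<noteq> x"
  shows "orbit_color x [c,c,c] = (if c = x then 61 else if c = \<tau> x then 103/108 else 1)"
    "orbit_color x [c,c,c,c] = (if c = x then 26641 else if c = \<tau> x then 1759/1944 else 1)"
    "orbit_color x [c,c,c,c,c] = (if c = x then 45778381 else if c = \<tau> x then 26381323/30233088 else 1)"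
  using assms wt_simps[of x] rat_color_power[of "wt \<tau> x 3 x 1" x "wt \<tau> x 2 x 1"]
    rat_color_power_inverse[of "wt \<tau> x 3 x 1" "\<tau> x" "wt \<tau> x 2 x 1"]
  by (auto simp: orbit_color_def wt_simps lin_color_trivial rat_color_def)

lemma orbit_color_pair:
  assumes "\<tau> x \<noteq> x"
  shows "orbit_color x [x,\<tau> x,x,x,\<tau> x] = -7/3" "orbit_color x [\<tau> x,x,x,\<tau> x,x] = -4"
    "orbit_color x [x,x,\<tau> x,x,\<tau> x] = 11" "orbit_color x [\<tau> x,x,\<tau> x,x,x] = 11" "orbit_color x [\<tau> x,x,x,x,\<tau> x] = 11"
    "orbit_color x [x,\<tau> x,x,\<tau> x,x] = 1" "orbit_color x [\<tau> x,x,\<tau> x,\<tau> x,x] = 11/6" "orbit_color x [x,\<tau> x,\<tau> x,x,\<tau> x] = 14/9"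
    "orbit_color x [\<tau> x,\<tau> x,x,\<tau> x,x] = 13/18" "orbit_color x [x,\<tau> x,x,\<tau> x,\<tau> x] = 13/18" "orbit_color x [x,\<tau> x,\<tau> x,\<tau> x,x] = 13/18"
    "orbit_color x [\<tau> x,x,\<tau> x,x,\<tau> x] = 1" "orbit_color x [x,\<tau> x,x,\<tau> x] = 1" "orbit_color x [\<tau> x,x,\<tau> x,x] = 1"
  unfolding orbit_color_def by (rule rat_color_orbit; use assms in \<open>simp add: wt_simps\<close>)+

lemma orbit_color_forms_outside:
  assumes "\<tau> x \<noteq> x" "c \<noteq> d" "w \<in> forms c d"
  shows "c \<notin> {x, \<tau> x} \<Longrightarrow> orbit_color x w = 1"
    "d \<notin> {x, \<tau> x} \<Longrightarrow> orbit_color x w = orbit_color x [c,c,c]"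
  unfolding orbit_color_def rat_color_def
  by (rule lin_color_trivial_first[OF assms(2) _ _ assms(3)]; simp add: wt_simps)
    (rule lin_color_trivial_second[OF assms(2) _ _ assms(3)]; simp add: wt_simps)

lemma orbit_color_abab:
  assumes "\<tau> x \<noteq> x" "c \<noteq> d"
  shows "orbit_color x [c,d,c,d] = 1"
proof -
  consider "c = x" "d = \<tau> x" | "d = x" "c = \<tau> x" | "c \<notin> {x, \<tau> x}" | "d \<notin> {x, \<tau> x}" using assms by auto
  then show ?thesis
    by cases (use assms in \<open>auto simp: orbit_color_pair\<close>, (auto simp: orbit_color_def rat_color_def lin_color_eval wt_simps)+)
qed

text \<open>The tables of values are read backwards: a color recovers the word, or at least its
  tripled letter. The number 45778381 is the color of the fifth power of \<open>x\<close>.\<close>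

lemma orbit_color_forms:
  assumes x: "\<tau> x \<noteq> x" and "c \<noteq> d" and w: "w \<in> forms c d"
  shows "orbit_color x w = -7/3 \<Longrightarrow> w = [x,\<tau> x,x,x,\<tau> x]"
    "orbit_color x w = -4 \<Longrightarrow> w = [\<tau> x,x,x,\<tau> x,x]"
    "orbit_color x w = 11 \<Longrightarrow> w \<in> {[x,x,\<tau> x,x,\<tau> x], [\<tau> x,x,\<tau> x,x,x], [\<tau> x,x,x,x,\<tau> x]}"
    "orbit_color x w = 61 \<Longrightarrow> c = x \<and> d \<noteq> \<tau> x"
    "orbit_color x w \<noteq> 45778381"
proof -
  consider "c = x" "d = \<tau> x" | "c = \<tau> x" "d = x" | "c \<notin> {x, \<tau> x}" | "c \<in> {x, \<tau> x}" "d \<notin> {x, \<tau> x}"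
    using assms by auto
  then have "(orbit_color x w = -7/3 \<longrightarrow> w = [x,\<tau> x,x,x,\<tau> x]) \<and>
    (orbit_color x w = -4 \<longrightarrow> w = [\<tau> x,x,x,\<tau> x,x]) \<and>
    (orbit_color x w = 11 \<longrightarrow> w \<in> {[x,x,\<tau> x,x,\<tau> x], [\<tau> x,x,\<tau> x,x,x], [\<tau> x,x,x,x,\<tau> x]}) \<and>
    (orbit_color x w = 61 \<longrightarrow> c = x \<and> d \<noteq> \<tau> x) \<and> orbit_color x w \<noteq> 45778381"
  proof cases
    case 1 then show ?thesis using w x by (auto simp: forms_def orbit_color_pair)
  next
    case 2 then show ?thesis using w x by (auto simp: forms_def orbit_color_pair)
  next
    case 3 then show ?thesis using orbit_color_forms_outside(1)[OF assms] by simp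
  next
    case 4 then show ?thesis using orbit_color_forms_outside(2)[OF assms] orbit_color_power(1)[OF x, of c] by auto
  qed
  then show "orbit_color x w = -7/3 \<Longrightarrow> w = [x,\<tau> x,x,x,\<tau> x]"
    "orbit_color x w = -4 \<Longrightarrow> w = [\<tau> x,x,x,\<tau> x,x]"
    "orbit_color x w = 11 \<Longrightarrow> w \<in> {[x,x,\<tau> x,x,\<tau> x], [\<tau> x,x,\<tau> x,x,x], [\<tau> x,x,x,x,\<tau> x]}"
    "orbit_color x w = 61 \<Longrightarrow> c = x \<and> d \<noteq> \<tau> x"
    "orbit_color x w \<noteq> 45778381" by blast+
qed

section \<open>Contractibility and separation of words of type (II)\<close>

lemma not_homotopic_swap_second:
  assumes "a \<noteq> b" "a \<noteq> \<tau> b" "\<tau> b \<noteq> b" and u: "u \<in> forms a b" and "u = [b,a,a,a,b] \<Longrightarrow> \<tau> a \<noteq> a"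
  shows "\<not> word_homotopic \<tau> u (map (id(b := \<tau> b)) u)"
proof
  assume h: "word_homotopic \<tau> u (map (id(b := \<tau> b)) u)"
  have wb: "wt \<tau> b r a r' b = r" "wt \<tau> b r a r' (\<tau> b) = 1 / r" "wt \<tau> b r a r' a = r'" for r r'
    using assms(1-3) by (auto simp: wt_def)
  have 1: "rat_color (wt \<tau> b 3 a 1) (wt \<tau> b 2 a (-1)) u = rat_color (wt \<tau> b 3 a 1) (wt \<tau> b 2 a (-1)) (map (id(b := \<tau> b)) u)"
    and 2: "rat_color (wt \<tau> b 3 a (-1)) (wt \<tau> b 2 a 1) u = rat_color (wt \<tau> b 3 a (-1)) (wt \<tau> b 2 a 1) (map (id(b := \<tau> b)) u)"
    by (rule rat_color_homotopic[OF inv _ _ _ _ _ _ h]; use assms(3) in simp)+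
  \<comment> \<open>Only the form \<open>baaab\<close> needs weights 3 and 2 on \<open>a\<close>
    too; they are admissible because \<open>\<tau> a \<noteq> a\<close> in this case.\<close>
  have 3: "rat_color (wt \<tau> b 3 a 3) (wt \<tau> b 2 a 2) u = rat_color (wt \<tau> b 3 a 3) (wt \<tau> b 2 a 2) (map (id(b := \<tau> b)) u)"
    if "u = [b,a,a,a,b]"
    by (rule rat_color_homotopic[OF inv _ _ _ _ _ _ h]; use assms(3,5) that in simp)+
  note S = rat_color_second_letter[OF assms(1,2)]
  note 4 = S(1)[of "wt \<tau> b 3 a (-1)" "wt \<tau> b 2 a 1"] S(2)[of "wt \<tau> b 3 a 1" "wt \<tau> b 2 a (-1)"]
    S(3)[of "wt \<tau> b 3 a 1" "wt \<tau> b 2 a (-1)"] S(4)[of "wt \<tau> b 3 a (-1)" "wt \<tau> b 2 a 1"]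
    S(5)[of "wt \<tau> b 3 a (-1)" "wt \<tau> b 2 a 1"] S(6)[of "wt \<tau> b 3 a 3" "wt \<tau> b 2 a 2"]
  from u consider "u = [a,b,a,a,b]" | "u = [b,a,a,b,a]" | "u = [a,a,b,a,b]" | "u = [b,a,b,a,a]" | "u = [b,a,a,a,b]" | "u = [a,b,a,b,a]"
    by (auto simp: forms_def)
  then show False
    using assms(1) by cases (use 1 2 3 4 in \<open>simp_all add: wb\<close>)
qed

lemma forms_map_eq:
  assumes "u \<in> forms a b" "v = map (id(b := d)) u" "a \<noteq> b" "d \<in> {b, \<tau> b}" "a \<noteq> \<tau> b"
    and "word_homotopic \<tau> u v" "u = [b,a,a,a,b] \<Longrightarrow> \<tau> a \<noteq> a"
  shows "u = v"
proof (cases "d = b")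
  case True
  then have "id(b := d) = id" by (simp add: fun_eq_iff)
  with assms(2) show ?thesis by simp
next
  case False
  with assms not_homotopic_swap_second[of a b u] show ?thesis by auto
qed

text \<open>The color identifies the form and the orbit of the second letter; the choice between
  \<open>b\<close> and \<open>\<tau> b\<close> is left to \<open>forms_map_eq\<close>.\<close>

lemma homotopic_forms_nonfixed:
  assumes "\<tau> a \<noteq> a" "b \<notin> {a, \<tau> a}" "d \<notin> {a, \<tau> a}" "u \<in> forms a b" "v \<in> forms a d"
    and h: "word_homotopic \<tau> u v"
  shows "u = v"
proof -
  let ?C = "rat_color (wt \<tau> a 3 b 1) (wt \<tau> a 2 b (-1))"
  have eq: "?C u = ?C v"
    by (rule rat_color_homotopic[OF inv _ _ _ _ _ _ h]) (use assms in simp_all)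
  have w: "wt \<tau> a r b r' a = r" for r r' by (simp add: wt_def)
  have ab: "a \<noteq> b" "a \<noteq> d" "a \<noteq> \<tau> b" using assms(2,3) inv by auto
  have "\<tau> b \<noteq> a" "\<tau> b \<noteq> \<tau> a" using assms(2) inv by auto metis
  then have wb: "wt \<tau> a 3 b 1 e = 1" "wt \<tau> a 2 b (-1) e = -1" if "e \<in> {b, \<tau> b}" for e
    using that assms(2) by (auto simp: wt_def)
  have d: "d \<in> {b, \<tau> b}"
  proof (rule ccontr)
    \<comment> \<open>Then \<open>d\<close> has trivial weights and \<open>v\<close> is colored like
      \<open>aaa\<close>, with a value that none of the six forms in \<open>a\<close>,
      \<open>b\<close> attains.\<close>
    assume "d \<notin> {b, \<tau> b}"
    then have "?C v = ?C [a,a,a]"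
      using assms(3) ab unfolding rat_color_def
      by (intro lin_color_trivial_second[OF ab(2) _ _ assms(5)]) (auto simp: wt_def)
    also have "\<dots> = 61" by (rule rat_color_power) (simp_all add: w)
    finally show False
      using eq assms(4) rat_color_nonfixed[of a b "wt \<tau> a 3 b 1" "wt \<tau> a 2 b (-1)"] ab
      by (auto simp: forms_def w wb)
  qed
  have "v = map (id(b := d)) u"
    using eq assms(4,5) rat_color_nonfixed[of a b "wt \<tau> a 3 b 1" "wt \<tau> a 2 b (-1)"]
      rat_color_nonfixed[of a d "wt \<tau> a 3 b 1" "wt \<tau> a 2 b (-1)"] ab wb[OF d]
    by (auto simp: forms_def w wb)
  from forms_map_eq[OF assms(4) this ab(1) d ab(3) h] assms(1) show ?thesis by blast
qed

lemma homotopic_forms_fixed: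
  assumes "\<tau> a = a" "\<tau> c = c" "a \<noteq> b" "c \<noteq> d" "u \<in> forms a b" "v \<in> forms c d"
    "u \<noteq> [b,a,a,a,b]" "v \<noteq> [d,c,c,c,d]" and h: "word_homotopic \<tau> u v"
  shows "u = v"
proof -
  let ?C = "\<lambda>w. (color1 \<tau> a b w, color2 \<tau> a b w)"
  have ab: "a \<noteq> \<tau> b" using assms(1,3) inv by metis
  have eq: "?C u = ?C v"
    using color12_homotopic[OF inv assms(1,3) h] by simp
  note V = color12_values[of a b \<tau>, OF assms(3) ab, unfolded prod.inject]
  note Vb = V[OF insertI1]
  have u: "?C u \<noteq> ((1, 0), (1, 0))"
    using assms(5,7) by (auto simp: forms_def Vb)
  \<comment> \<open>If either letter of \<open>v\<close> had trivial maps, \<open>v\<close> would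
    get the initial color in both colorings, unlike \<open>u\<close>.\<close>
  have c: "c \<in> {a, b, \<tau> b}"
  proof (rule ccontr)
    assume "c \<notin> {a, b, \<tau> b}"
    then have "?C v = ((1, 0), (1, 0))"
      unfolding color1_def color2_def by (auto simp: mat_def intro!: lin_color_trivial_first[OF assms(4) _ _ assms(6)])
    with eq u show False by simp
  qed
  have d: "d \<in> {a, b, \<tau> b}"
  proof (rule ccontr)
    assume "d \<notin> {a, b, \<tau> b}"
    then have "?C v = ?C [c,c,c]"
      unfolding color1_def color2_def by (auto simp: mat_def intro!: lin_color_trivial_second[OF assms(4) _ _ assms(6)])
    also have "\<dots> = ((1, 0), (1, 0))" by (simp add: color12_power)
    finally show False using eq u by simp
  qed
  show ?thesis
  proof (cases "c = a")
    case True
    with d assms(4) have d: "d \<in> {b, \<tau> b}" by auto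
    have "v = map (id(b := d)) u"
      using eq assms(3,5-8) True by (auto simp: forms_def Vb V[OF d])
    from forms_map_eq[OF assms(5) this assms(3) d ab h] assms(7) show ?thesis by blast
  next
    case False
    \<comment> \<open>A fixed letter in the orbit of \<open>b\<close> makes this orbit a single
      point, so \<open>u\<close> and \<open>v\<close> use the same two letters with exchanged
      multiplicities.\<close>
    then have "c = b" "\<tau> b = b" using c assms(2) inv by auto
    with d assms(4) have "d = a" by auto
    then show ?thesis
      using eq assms(3,5-8) \<open>c = b\<close> by (auto simp: forms_def Vb)
  qed
qed

lemma contractible_forms:
  assumes "a \<noteq> b" "w \<in> forms a b"
  shows "contractible \<tau> w \<longleftrightarrow> w = [b,a,a,a,b] \<and> \<tau> a = a \<or> w = [a,b,a,b,a] \<and> \<tau> a = b"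
proof
  assume "contractible \<tau> w"
  then have h: "word_homotopic \<tau> w []" by (simp add: contractible_iff)
  show "w = [b,a,a,a,b] \<and> \<tau> a = a \<or> w = [a,b,a,b,a] \<and> \<tau> a = b"
  proof (cases "\<tau> a = a")
    case True
    have ab: "a \<noteq> \<tau> b" using assms(1) True inv by metis
    have "(color1 \<tau> a b w, color2 \<tau> a b w) = ((1, 0), (1, 0))"
      using color12_homotopic[OF inv True assms(1) h] by (simp add: color1_def color2_def lin_color_Nil)
    then show ?thesis
      using True assms color12_values[of a b \<tau> b, OF assms(1) ab] by (auto simp: forms_def)
  next
    case False
    have 1: "orbit_color a w = 1" using orbit_color_homotopic[OF False h] by (simp add: orbit_color_Nil)
    show ?thesis
    proof (cases "b = \<tau> a")
      case True
      then show ?thesis using False 1 assms by (auto simp: forms_def orbit_color_pair)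
    next
      case b: False
      then show ?thesis
        using False 1 orbit_color_forms_outside(2)[OF False assms] assms(1) orbit_color_power(1)[OF False, of a] by auto
    qed
  qed
next
  assume "w = [b,a,a,a,b] \<and> \<tau> a = a \<or> w = [a,b,a,b,a] \<and> \<tau> a = b"
  then show "contractible \<tau> w"
    using assms(1) contractible_baaab[OF inv] contractible_ababa[OF inv] by blast
qed

lemma contractible_power:
  "contractible \<tau> [a,a,a] \<longleftrightarrow> \<tau> a = a" "contractible \<tau> [a,a,a,a,a] \<longleftrightarrow> \<tau> a = a"
proof -
  have "\<not> contractible \<tau> [a,a,a]" "\<not> contractible \<tau> [a,a,a,a,a]" if "\<tau> a \<noteq> a"
    using orbit_color_homotopic[OF that] orbit_color_power[OF that, of a] orbit_color_Nil[of a]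
    by (auto simp: contractible_iff)
  then show "contractible \<tau> [a,a,a] \<longleftrightarrow> \<tau> a = a" "contractible \<tau> [a,a,a,a,a] \<longleftrightarrow> \<tau> a = a"
    using contractible_aaa[OF inv] contractible_aaaaa[OF inv] by blast+
qed

definition exceptional :: "'a list \<Rightarrow> 'a list \<Rightarrow> bool" where
  "exceptional u v \<longleftrightarrow> (\<exists>a b. a = \<tau> b \<and> a \<noteq> b \<and>
     u \<in> {[a, a, b, a, b], [b, a, b, a, a], [b, a, a, a, b]} \<and>
     v \<in> {[a, a, b, a, b], [b, a, b, a, a], [b, a, a, a, b]})"

lemma exceptional_sym: "exceptional u v \<Longrightarrow> exceptional v u"
  unfolding exceptional_def by blast

lemma exceptional_homotopic: "exceptional u v \<Longrightarrow> word_homotopic \<tau> u v"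
proof -
  assume "exceptional u v"
  then obtain a b where ab: "\<tau> a = b" "a \<noteq> b"
    and uv: "u \<in> {[a, a, b, a, b], [b, a, b, a, a], [b, a, a, a, b]}"
     "v \<in> {[a, a, b, a, b], [b, a, b, a, a], [b, a, a, a, b]}"
    unfolding exceptional_def using inv by metis
  have *: "word_homotopic \<tau> [b, a, a, a, b] w" if "w \<in> {[a, a, b, a, b], [b, a, b, a, a], [b, a, a, a, b]}" for w
    using that homotopic_exception[OF inv ab] word_homotopic_refl[of \<tau> "[b, a, a, a, b]"] by auto
  show ?thesis by (rule word_homotopic_trans[OF word_homotopic_sym[OF *[OF uv(1)]] *[OF uv(2)]])
qed

text \<open>The color of the fifth power of \<open>a\<close> occurs for no two-letter form, and
  among fifth powers only for that of \<open>a\<close>.\<close>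

lemma homotopic_power:
  assumes "\<tau> a \<noteq> a" "is_typeII v" "word_homotopic \<tau> [a,a,a,a,a] v"
  shows "v = [a,a,a,a,a]"
proof -
  have 1: "orbit_color a v = 45778381"
    using orbit_color_homotopic[OF assms(1,3)] orbit_color_power(3)[OF assms(1), of a] by simp
  have "v \<notin> forms c d" if "c \<noteq> d" for c d
    using orbit_color_forms(5)[OF assms(1) that] 1 by blast
  with assms(2) obtain c where "v = [c,c,c,c,c]"
    by (auto simp: is_typeII_def typeII_words_def forms_def numeral_eq_Suc)
  with 1 show ?thesis using orbit_color_power(3)[OF assms(1), of c] by (auto split: if_splits)
qed

lemma typeII_cases:
  assumes "is_typeII v"
  obtains c where "v = [c,c,c,c,c]" | c d where "c \<noteq> d" "v \<in> forms c d"
  using assms unfolding is_typeII_def typeII_words_def forms_def by (auto simp: numeral_eq_Suc)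

text \<open>If \<open>b = \<tau> a\<close>, the color determines \<open>v\<close> up to the
  exceptional triple; otherwise \<open>u\<close> has color 61, which forces the same tripled letter
  in \<open>v\<close>.\<close>

lemma homotopic_nonfixed:
  assumes "\<tau> a \<noteq> a" "a \<noteq> b" "u \<in> forms a b" "\<not> contractible \<tau> u" "c \<noteq> d" "v \<in> forms c d"
    and h: "word_homotopic \<tau> u v"
  shows "u = v \<or> exceptional u v"
proof (cases "b = \<tau> a")
  case True
  note C = orbit_color_forms[OF assms(1,5,6), folded orbit_color_homotopic[OF assms(1) h]]
  have "u \<noteq> [a,\<tau> a,a,\<tau> a,a]" using assms(4) contractible_forms[OF assms(2,3)] True by blast
  with assms(3) True consider "u = [a,\<tau> a,a,a,\<tau> a]" | "u = [\<tau> a,a,a,\<tau> a,a]"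
    | "u \<in> {[a,a,\<tau> a,a,\<tau> a], [\<tau> a,a,\<tau> a,a,a], [\<tau> a,a,a,a,\<tau> a]}"
    by (auto simp: forms_def)
  then show ?thesis
  proof cases
    case 3
    then have "orbit_color a u = 11" using orbit_color_pair[OF assms(1)] by auto
    from C(3)[OF this] 3 have "exceptional u v"
      unfolding exceptional_def using assms(1) inv by (intro exI[of _ a] exI[of _ "\<tau> a"]) metis
    then show ?thesis ..
  qed (use C(1,2) orbit_color_pair[OF assms(1)] in auto)
next
  case False
  have "orbit_color a u = 61"
    using orbit_color_forms_outside(2)[OF assms(1-3)] False assms(2) orbit_color_power(1)[OF assms(1), of a] by auto
  then have "c = a" "d \<noteq> \<tau> a"
    using orbit_color_forms(4)[OF assms(1,5,6)] orbit_color_homotopic[OF assms(1) h] by auto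
  then show ?thesis
    using homotopic_forms_nonfixed[OF assms(1), of b d u v] False assms(2,3,5,6) h by auto
qed

lemma typeII_homotopic:
  assumes "is_typeII u" "is_typeII v" and nu: "\<not> contractible \<tau> u" and nv: "\<not> contractible \<tau> v"
    and h: "word_homotopic \<tau> u v"
  shows "u = v \<or> exceptional u v"
proof -
  note h' = word_homotopic_sym[OF h]
  from assms(1) show ?thesis
  proof (cases rule: typeII_cases)
    case (1 a)
    then show ?thesis using homotopic_power[of a v] contractible_power(2) nu h assms(2) by blast
  next
    case u: (2 a b)
    from assms(2) show ?thesis
    proof (cases rule: typeII_cases)
      case (1 c)
      then show ?thesis using homotopic_power[of c u] contractible_power(2) nv h' assms(1) by blast
    next
      case v: (2 c d)
      \<comment> \<open>By symmetry a nonfixed tripled letter in either word suffices. If both are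
        fixed, the form \<open>baaab\<close> is excluded as contractible.\<close>
      consider "\<tau> a \<noteq> a" | "\<tau> c \<noteq> c" | "\<tau> a = a" "\<tau> c = c" by blast
      then show ?thesis
      proof cases
        case 1 then show ?thesis using homotopic_nonfixed[OF _ u nu v h] by blast
      next
        case 2 then show ?thesis using homotopic_nonfixed[OF _ v nv u h'] exceptional_sym by blast
      next
        case 3
        then have "u \<noteq> [b,a,a,a,b]" "v \<noteq> [d,c,c,c,d]"
          using contractible_forms[OF u] contractible_forms[OF v] nu nv by blast+
        then show ?thesis using homotopic_forms_fixed[OF 3 u(1) v(1) u(2) v(2) _ _ h] by blast
      qed
    qed
  qed
qed

section \<open>Comparison with words of length at most four\<close>

lemma orbit_color_short:
  assumes x: "\<tau> x \<noteq> x" and "length v \<le> 4"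
  shows "orbit_color x v \<notin> {-7/3, -4, 11, 45778381}"
    "orbit_color x v = 61 \<Longrightarrow> desing_word v = desing_word [x,x,x]"
proof -
  have c: "orbit_color x v = orbit_color x w" if "desing_word v = desing_word w" for w
    unfolding orbit_color_def rat_color_def by (rule lin_color_cong[OF that])
  have p: "orbit_color x [c,c] = 1" "c \<noteq> d \<Longrightarrow> orbit_color x [c,c,d,d] = 1" "c \<noteq> d \<Longrightarrow> orbit_color x [c,d,d,c] = 1" for c d
    by (simp_all add: orbit_color_def rat_color_def lin_color_pairs)
  have n: "desing_word ([] :: 'a list) = []" by (rule desing_word_Nil)
  from assms(2) have "orbit_color x v \<notin> {-7/3, -4, 11, 45778381} \<and>
    (orbit_color x v = 61 \<longrightarrow> desing_word v = desing_word [x,x,x])"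
  proof (cases rule: desing_word_short)
    case 1
    then have "desing_word v = desing_word []" using n by simp
    from c[OF this] have "orbit_color x v = 1" by (simp only: orbit_color_Nil)
    then show ?thesis by simp
  qed (use orbit_color_power[OF x] orbit_color_abab[OF x] c p in \<open>auto split: if_splits\<close>)
  then show "orbit_color x v \<notin> {-7/3, -4, 11, 45778381}"
    "orbit_color x v = 61 \<Longrightarrow> desing_word v = desing_word [x,x,x]" by blast+
qed

lemma typeII_not_short:
  assumes "is_typeII u" and nu: "\<not> contractible \<tau> u" and l: "length v \<le> 4"
  shows "\<not> word_homotopic \<tau> u v"
proof
  assume h: "word_homotopic \<tau> u v"
  from assms(1) show False
  proof (cases rule: typeII_cases)
    case (1 a)
    then have a: "\<tau> a \<noteq> a" using nu contractible_power(2) by blast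
    show False
      using orbit_color_short(1)[OF a l] orbit_color_homotopic[OF a h] orbit_color_power(3)[OF a, of a] 1 by simp
  next
    case u: (2 a b)
    show False
    proof (cases "\<tau> a = a")
      case True
      have ab: "a \<noteq> \<tau> b" using u(1) True inv by metis
      let ?C = "\<lambda>w. (color1 \<tau> a b w, color2 \<tau> a b w)"
      have c: "?C v = ?C w" if "desing_word v = desing_word w" for w
        by (simp only: color1_def color2_def lin_color_cong[OF that])
      have p: "?C [] = ((1,0),(1,0))" "?C [e,e] = ((1,0),(1,0))" for e
        by (simp_all add: color1_def color2_def lin_color_pairs(1) lin_color_Nil)
      have p': "?C [e,e,d,d] = ((1,0),(1,0))" "?C [e,d,d,e] = ((1,0),(1,0))" if "e \<noteq> d" for e d
        using that by (simp_all add: color1_def color2_def lin_color_pairs(2,3))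
      have p'': "?C [e,e,e] = ((1,0),(1,0))" "?C [e,e,e,e] = ((1,0),(1,0))" for e
        by (simp_all add: color12_power)
      \<comment> \<open>Among the short patterns only \<open>cdcd\<close> can have a pair of colors
        different from the initial one, and its other possible values are not attained by the
        non-contractible forms in \<open>a\<close>, \<open>b\<close>.\<close>
      have "?C v \<in> {((1, 0), (1, 0)), ((0, 0), (-4, -3)), ((-3, -1), (-1, -2))}"
        using l
      proof (cases rule: desing_word_short)
        case 1
        then have "desing_word v = desing_word []" by (simp add: desing_word_Nil)
        from c[OF this] p(1) show ?thesis by simp
      next
        case (2 e) from c[OF this] p(2)[of e] show ?thesis by simp
      next
        case (3 e) from c[OF this] p''(1)[of e] show ?thesis by simp
      next
        case (4 e) from c[OF this] p''(2)[of e] show ?thesis by simp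
      next
        case (5 e d) from c[OF this(2)] p'(1)[OF this(1)] show ?thesis by simp
      next
        case (6 e d) from c[OF this(2)] p'(2)[OF this(1)] show ?thesis by simp
      next
        case (7 e d) from c[OF this(2)] color12_abab[of a b \<tau> e d, OF u(1) ab this(1)] show ?thesis by simp
      qed
      moreover have "?C u = ?C v" using color12_homotopic[OF inv True u(1) h] by simp
      moreover have "u \<noteq> [b,a,a,a,b]" using nu contractible_forms[OF u] True by blast
      ultimately show False
        using u color12_values[of a b \<tau> b, OF u(1) ab] by (auto simp: forms_def)
    next
      case False
      note eq = orbit_color_homotopic[OF False h] and S = orbit_color_short[OF False l]
      show False
      proof (cases "b = \<tau> a")
        case True
        have "u \<noteq> [a,\<tau> a,a,\<tau> a,a]" using nu contractible_forms[OF u] True by blast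
        then show False using True u S(1) eq orbit_color_pair[OF False] by (auto simp: forms_def)
      next
        case b: False
        have "orbit_color a u = 61"
          using orbit_color_forms_outside(2)[OF False u] b u(1) orbit_color_power(1)[OF False, of a] by auto
        \<comment> \<open>The value 61 forces \<open>v\<close> to have the desingularization of
          \<open>aaa\<close>; the coloring with weights 1 and -1 on \<open>b\<close> then separates
          \<open>u\<close> from \<open>aaa\<close>.\<close>
        then have "word_homotopic \<tau> u [a,a,a]" using S(2) eq h word_homotopic_cong by metis
        then have "rat_color (wt \<tau> a 3 b 1) (wt \<tau> a 2 b (-1)) u = rat_color (wt \<tau> a 3 b 1) (wt \<tau> a 2 b (-1)) [a,a,a]"
          by (intro rat_color_homotopic[OF inv]) (use False in simp_all)
        then show False
          using rat_color_nonfixed[of a b "wt \<tau> a 3 b 1" "wt \<tau> a 2 b (-1)"] u b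
            rat_color_power(1)[of "wt \<tau> a 3 b 1" a "wt \<tau> a 2 b (-1)"]
          by (simp add: wt_def) (auto simp: forms_def)
      qed
    qed
  qed
qed

end

text \<open>Every letter must recur, so either no position or two or three positions differ from the
  first letter, and those that differ all carry one common letter.\<close>

lemma length5_multiplicity_one_free:
  assumes "length w = 5" "mult_one_free w"
  shows "is_typeI w \<or> is_typeII w"
proof -
  obtain p q r s t where w: "w = [p, q, r, s, t]"
    using assms(1) by (auto simp: numeral_eq_Suc length_Suc_conv)
  have m: "x \<in> set w \<Longrightarrow> 2 \<le> count_list w x" for x
    using assms(2) by (simp add: mult_one_free_def)
  note m' = m[of p] m[of q] m[of r] m[of s] m[of t]
  have I: "is_typeI w" if "a \<noteq> b" "w \<in> typeI_words a b" for a b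
    using that unfolding is_typeI_def by blast
  have II: "is_typeII w" if "a \<noteq> b" "w \<in> typeII_words a b" for a b
    using that unfolding is_typeII_def by blast
  have III: "is_typeII w" if "w = [a, a, a, a, a]" for a
    using that unfolding is_typeII_def by (auto simp: numeral_eq_Suc)
  show ?thesis
    using m' I[of p q] I[of p r] I[of p s] I[of q p] I[of r p]
      II[of p q] II[of p r] II[of p s] II[of q p] II[of r p] III[of p]
    by (cases "q = p"; cases "r = p"; cases "s = p"; cases "t = p")
      (auto simp: w typeI_words_def typeII_words_def split: if_splits)
qed

theorem theorem9p2:
  fixes \<tau> :: "'a \<Rightarrow> 'a"
  assumes inv: "\<forall>x. \<tau> (\<tau> x) = x"
  shows "(\<forall>w :: 'a list. length w = 5 \<and> mult_one_free w \<longrightarrow> is_typeI w \<or> is_typeII w)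
   \<and> (\<forall>a b. a \<noteq> b \<longrightarrow> (\<forall>w \<in> typeI_words a b.
          word_homotopic \<tau> w [a, a, a] \<and> (contractible \<tau> w \<longleftrightarrow> \<tau> a = a)))
   \<and> (\<forall>a. contractible \<tau> (replicate 5 a) \<longleftrightarrow> \<tau> a = a)
   \<and> (\<forall>a b. a \<noteq> b \<longrightarrow> (contractible \<tau> [b, a, a, a, b] \<longleftrightarrow> \<tau> a = a))
   \<and> (\<forall>a b. a \<noteq> b \<longrightarrow> (contractible \<tau> [a, b, a, b, a] \<longleftrightarrow> \<tau> a = b))
   \<and> (\<forall>a b. a \<noteq> b \<longrightarrow> \<not> contractible \<tau> [a, b, a, a, b] \<and> \<not> contractible \<tau> [b, a, a, b, a]
          \<and> \<not> contractible \<tau> [a, a, b, a, b] \<and> \<not> contractible \<tau> [b, a, b, a, a])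
   \<and> (\<forall>u v. is_typeII u \<and> is_typeII v \<and> \<not> contractible \<tau> u \<and> \<not> contractible \<tau> v \<longrightarrow>
          (word_homotopic \<tau> u v \<longleftrightarrow>
             u = v \<or> (\<exists>a b. a = \<tau> b \<and> a \<noteq> b \<and>
                         u \<in> {[a, a, b, a, b], [b, a, b, a, a], [b, a, a, a, b]} \<and>
                         v \<in> {[a, a, b, a, b], [b, a, b, a, a], [b, a, a, a, b]})))
   \<and> (\<forall>w v. is_typeII w \<and> \<not> contractible \<tau> w \<and> length v \<le> 4 \<longrightarrow> \<not> word_homotopic \<tau> w v)"
proof (intro conjI allI impI ballI; (elim conjE)?)
  fix w :: "'a list" assume "length w = 5" "mult_one_free w"
  then show "is_typeI w \<or> is_typeII w" by (rule length5_multiplicity_one_free)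
next
  fix a b :: 'a and w assume w: "a \<noteq> b" "w \<in> typeI_words a b"
  show h: "word_homotopic \<tau> w [a, a, a]" by (rule typeI_homotopic_aaa[OF w])
  show "contractible \<tau> w \<longleftrightarrow> \<tau> a = a"
    using homotopic_contractible[OF h] homotopic_contractible[OF word_homotopic_sym[OF h]]
      contractible_power(1)[OF inv] by blast
next
  fix a show "contractible \<tau> (replicate 5 a) \<longleftrightarrow> \<tau> a = a"
    using contractible_power(2)[OF inv, of a] by (simp add: numeral_eq_Suc)
next
  fix a b :: 'a assume ab: "a \<noteq> b"
  note C = contractible_forms[OF inv ab]
  show "contractible \<tau> [b, a, a, a, b] \<longleftrightarrow> \<tau> a = a" "contractible \<tau> [a, b, a, b, a] \<longleftrightarrow> \<tau> a = b"
    "\<not> contractible \<tau> [a, b, a, a, b]" "\<not> contractible \<tau> [b, a, a, b, a]"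
    "\<not> contractible \<tau> [a, a, b, a, b]" "\<not> contractible \<tau> [b, a, b, a, a]"
    using ab by (subst C; auto simp: forms_def)+
next
  fix u v assume uv: "is_typeII u" "is_typeII v" "\<not> contractible \<tau> u" "\<not> contractible \<tau> v"
  show "word_homotopic \<tau> u v \<longleftrightarrow>
             u = v \<or> (\<exists>a b. a = \<tau> b \<and> a \<noteq> b \<and>
                         u \<in> {[a, a, b, a, b], [b, a, b, a, a], [b, a, a, a, b]} \<and>
                         v \<in> {[a, a, b, a, b], [b, a, b, a, a], [b, a, a, a, b]})"
    unfolding exceptional_def[OF inv, symmetric]
    using typeII_homotopic[OF inv uv] exceptional_homotopic[OF inv] word_homotopic_refl by blast
next
  fix w v :: "'a list" assume "is_typeII w" "\<not> contractible \<tau> w" "length v \<le> 4"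
  then show "\<not> word_homotopic \<tau> w v" by (rule typeII_not_short[OF inv])
qed

end
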